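(* Let $\sigma>0$ and $\alpha>1$. For each $n$, let $\mu^n$ be a homogeneous Poisson point process on $\mathbb{R}^n$ of intensity $\lambda_n=e^{nR}$ with $R=\frac12\ln\frac{1}{2\pi e\alpha^2\sigma^2}$, and let the displacement vectors be Gaussian with i.i.d. centered coordinates of variance $\sigma^2$. Let decoding be maximum likelihood (i.e. the decoding region of each point is its Voronoi cell), let $p_e(n)$ be the probability of error, and let $\underline{\pi}(\mathrm{Poi},\mathcal{L}(\mathrm{WGN}),\alpha,\mathrm{WGN})=\liminf_{n\to\infty}-\frac1n\ln p_e(n)$. Then $$\underline{\pi}(\mathrm{Poi},\mathcal{L}(\mathrm{WGN}),\alpha,\mathrm{WGN})=\begin{cases}\frac{\alpha^2}{2}-\frac12-\ln\alpha & \text{if }1\le\alpha<\sqrt2,\\[2pt] \frac12-\ln2+\ln\alpha & \text{if }\sqrt2\le\alpha<\infty.\end{cases}$$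
   Context: Logarithms are natural. Write $\mu^n=\sum_k\epsilon_{T_k^n}$. Each point $T_k^n$ carries a displacement vector $D_k^n$, i.i.d. in $k$ and independent of $\mu^n$. $\mathcal{V}_0^n$ is the (open) Voronoi cell of the point $T_0^n=0$ with respect to $\mu^n$ under the Palm probability $\mathbb{P}_0^n$ of $\mu^n$; the probability of error is $p_e(n)=\mathbb{P}_0^n(D_0^n\notin\mathcal{V}_0^n)$. *)

theory Defs
  imports "HOL-Probability.Probability"
begin

(* Since the dimension n is a variable of the statement, a vector of R^n is an extensional
   function on {..<n}, an element of the carrier of the product measure below. *)

type_synonym vec = "nat \<Rightarrow> real"

definition lebesgue_n :: "nat \<Rightarrow> vec measure" where
  "lebesgue_n n = (\<Pi>\<^sub>M i\<in>{..<n}. lborel)"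

definition vec_diff :: "nat \<Rightarrow> vec \<Rightarrow> vec \<Rightarrow> vec" where
  "vec_diff n x y = (\<lambda>i\<in>{..<n}. x i - y i)"

definition vec_dist :: "nat \<Rightarrow> vec \<Rightarrow> vec \<Rightarrow> real" where
  "vec_dist n x y = sqrt (\<Sum>i<n. (x i - y i)\<^sup>2)"

definition unit_cube :: "nat \<Rightarrow> vec set" where
  "unit_cube n = (\<Pi>\<^sub>E i\<in>{..<n}. {0..<1})"

(* The random counting measure that puts a unit mass at each of the points T k; several indices
   may give the same point, which then has a multiplicity. *)

definition point_process :: "nat \<Rightarrow> (nat \<Rightarrow> 'a \<Rightarrow> vec) \<Rightarrow> 'a \<Rightarrow> vec measure" where
  "point_process n T \<omega> = distr (count_space UNIV) (lebesgue_n n) (\<lambda>k. T k \<omega>)"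

definition homogeneous_poisson ::
  "'a measure \<Rightarrow> nat \<Rightarrow> real \<Rightarrow> ('a \<Rightarrow> vec measure) \<Rightarrow> bool" where
  "homogeneous_poisson M n \<Lambda> \<mu> \<longleftrightarrow>
     (\<forall>\<omega>\<in>space M. sets (\<mu> \<omega>) = sets (lebesgue_n n)) \<and>
     (\<forall>B\<in>sets (lebesgue_n n). (\<lambda>\<omega>. emeasure (\<mu> \<omega>) B) \<in> borel_measurable M) \<and>
     (\<forall>B\<in>sets (lebesgue_n n). emeasure (lebesgue_n n) B < \<infinity> \<longrightarrow>
        (\<forall>j::nat. measure M {\<omega> \<in> space M. emeasure (\<mu> \<omega>) B = of_nat j} =
           exp (- (\<Lambda> * measure (lebesgue_n n) B)) * (\<Lambda> * measure (lebesgue_n n) B) ^ j / fact j)) \<and>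
     (\<forall>(I::nat set) B. finite I \<longrightarrow> B ` I \<subseteq> sets (lebesgue_n n) \<longrightarrow> disjoint_family_on B I \<longrightarrow>
        prob_space.indep_vars M (\<lambda>_. borel) (\<lambda>i \<omega>. emeasure (\<mu> \<omega>) (B i)) I)"

definition white_gaussian :: "nat \<Rightarrow> real \<Rightarrow> vec measure" where
  "white_gaussian n \<sigma> = (\<Pi>\<^sub>M i\<in>{..<n}. density lborel (normal_density 0 \<sigma>))"

(* The displacements are independent of the whole enumeration (T k), not merely of the counting
   measure: otherwise the points could be enumerated in an order that depends on the D k, and D k
   would not be the mark of an arbitrary point. *)

definition iid_displacements ::
  "'a measure \<Rightarrow> nat \<Rightarrow> (nat \<Rightarrow> 'a \<Rightarrow> vec) \<Rightarrow> (nat \<Rightarrow> 'a \<Rightarrow> vec) \<Rightarrow> vec measure \<Rightarrow> bool" where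
  "iid_displacements M n T D \<nu> \<longleftrightarrow>
     prob_space.indep_vars M (\<lambda>_. lebesgue_n n) D UNIV \<and>
     (\<forall>k. distr M (lebesgue_n n) (D k) = \<nu>) \<and>
     prob_space.indep_var M
       (\<Pi>\<^sub>M k\<in>UNIV. lebesgue_n n) (\<lambda>\<omega> k. T k \<omega>) (\<Pi>\<^sub>M k\<in>UNIV. lebesgue_n n) (\<lambda>\<omega> k. D k \<omega>)"

(* Marked configurations, as sequences of pairs (point, displacement vector).  recentre n k s
   translates all points so that the k-th one is at the origin, leaves the marks unchanged, and
   exchanges the indices 0 and k, so that the point at the origin has index 0. *)

definition configurations :: "nat \<Rightarrow> (nat \<Rightarrow> vec \<times> vec) measure" where
  "configurations n = (\<Pi>\<^sub>M k\<in>UNIV. lebesgue_n n \<Otimes>\<^sub>M lebesgue_n n)"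

definition recentre :: "nat \<Rightarrow> nat \<Rightarrow> (nat \<Rightarrow> vec \<times> vec) \<Rightarrow> nat \<Rightarrow> vec \<times> vec" where
  "recentre n k s =
     (\<lambda>j. let (t, d) = s (Transposition.transpose 0 k j) in (vec_diff n t (fst (s k)), d))"

definition intensity :: "'a measure \<Rightarrow> nat \<Rightarrow> (nat \<Rightarrow> 'a \<Rightarrow> vec) \<Rightarrow> ennreal" where
  "intensity M n T = (\<integral>\<^sup>+ \<omega>. emeasure (point_process n T \<omega>) (unit_cube n) \<partial>M)"

(* The Palm probability P_0(G) = E [#{k. T_k in [0,1)^n and recentre_k (T, D) in G}] / intensity. *)

definition palm ::
  "'a measure \<Rightarrow> nat \<Rightarrow> (nat \<Rightarrow> 'a \<Rightarrow> vec) \<Rightarrow> (nat \<Rightarrow> 'a \<Rightarrow> vec) \<Rightarrow> (nat \<Rightarrow> vec \<times> vec) measure" where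
  "palm M n T D =
     scale_measure (inverse (intensity M n T))
       (distr
         (density (M \<Otimes>\<^sub>M count_space UNIV) (\<lambda>(\<omega>, k). indicator (unit_cube n) (T k \<omega>)))
         (configurations n)
         (\<lambda>(\<omega>, k). recentre n k (\<lambda>j. (T j \<omega>, D j \<omega>))))"

definition voronoi_cell :: "nat \<Rightarrow> vec set \<Rightarrow> vec \<Rightarrow> vec set" where
  "voronoi_cell n S t =
     {y \<in> space (lebesgue_n n). \<forall>t'\<in>S. t' \<noteq> t \<longrightarrow> vec_dist n y t < vec_dist n y t'}"

(* Under the Palm probability fst (s 0) is the origin, so no translation of the mark is needed. *)

definition error_probability ::
  "'a measure \<Rightarrow> nat \<Rightarrow> (nat \<Rightarrow> 'a \<Rightarrow> vec) \<Rightarrow> (nat \<Rightarrow> 'a \<Rightarrow> vec) \<Rightarrow> real" where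
  "error_probability M n T D =
     measure (palm M n T D)
       {s \<in> space (configurations n).
          snd (s 0) \<notin> voronoi_cell n (range (\<lambda>k. fst (s k))) (fst (s 0))}"

(* The case distinction gives - ln 0 = \<infinity>, where the library has ln 0 = 0. *)

definition lower_error_exponent :: "(nat \<Rightarrow> real) \<Rightarrow> ereal" where
  "lower_error_exponent p =
     liminf (\<lambda>n. if p n = 0 then \<infinity> else ereal (- (1 / real n) * ln (p n)))"

end

(* A point of the process displaced by d is decoded wrongly iff another point lies in the ball of
   radius |d| around its displaced position.  Hence, with V(r) the volume of the ball of radius r,

     p_e(n) = E[1 - exp(- lambda_n V(|D|))].

   Instead of the Mecke formula, this is derived by cutting the unit cube into m^n small cells: up
   to errors that vanish as m grows, a cell contributes when it and the part outside it of a fixed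
   ball are both occupied, and these two counts are independent.

   For the exponent write |D|^2 = n sigma^2 w, so that lambda_n V(|D|) is about (w / alpha^2)^(n/2).
   From above, 1 - exp(-x) <= x^s for 0 <= s <= 1 and ln w is bounded by its tangent at 1 + s, which
   reduces everything to the exponential moments of |D|^2; s = min(2, alpha^2) - 1 is optimal.  From
   below, only the shell w = v with v = min(2, alpha^2) = 1 + s is kept: its probability is found by
   comparing with the Gaussian law of variance sigma^2 v, which concentrates on this shell.  The same
   comparison, with Lebesgue measure in place of the other Gaussian law, gives V(r) up to
   subexponential factors, so that no Stirling formula is needed. *)

theory Submission
  imports Defs
begin

section \<open>Euclidean geometry on extensional functions\<close>

text \<open>Nothing is known about the law of an individual \<open>T k\<close>; only the joint law
  of counts on disjoint sets is prescribed. So each displacement is first frozen, index by index, by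
  its independence of the whole enumeration, and only the sum over all indices becomes a functional
  of counts that the cells can resolve. The exponent balances the cost of a long displacement
  against the chance of a rival. The shell w = v has probability exponent (v - 1 - ln v) / 2, and
  for v <= alpha^2 its error ball is occupied with exponent (ln(alpha^2) - ln v) / 2. The sum
  decreases in v up to v = 2. If alpha^2 < 2, errors therefore come from displacements so long that
  a rival costs nothing on the exponential scale; if alpha^2 > 2, from shorter ones, for which a
  rival is still exponentially rare. The two bounds meet because weighting the Gaussian density with
  exp(u |x|^2 / (2 sigma^2)) gives a multiple of the Gaussian density of variance sigma^2 / (1 - u).
  For u = s / (1 + s) this is sigma^2 (1 + s), so the tangent used from above touches on the very
  shell kept from below.\<close>

interpretation lborel_product: product_sigma_finite "\<lambda>_::nat. lborel :: real measure"
  by standard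

lemma space_lebesgue_n: "space (lebesgue_n n) = extensional {..<n}"
  by (simp add: lebesgue_n_def space_PiM PiE_UNIV_domain PiE_def)

text \<open>Outside \<open>{..<n}\<close> extensional functions are constantly
  \<open>undefined\<close>, so \<open>i\<close> can be arbitrary and sums over coordinates are
  measurable without side conditions.\<close>

lemma measurable_lebesgue_n_component [measurable (raw)]:
  assumes "f \<in> measurable M (lebesgue_n n)"
  shows "(\<lambda>x. f x i) \<in> borel_measurable M"
proof (cases "i < n")
  case True
  then have "(\<lambda>y. y i) \<in> measurable (lebesgue_n n) lborel"
    unfolding lebesgue_n_def by (intro measurable_component_singleton) auto
  from measurable_compose[OF assms this] show ?thesis by simp
next
  case False
  have "f x i = undefined" if "x \<in> space M" for x
    using measurable_space[OF assms that] False by (auto simp: space_lebesgue_n extensional_def)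
  then show ?thesis by (subst measurable_cong) auto
qed

lemma measurable_lebesgue_n_restrict:
  assumes "\<And>i. i < n \<Longrightarrow> (\<lambda>x. f x i) \<in> borel_measurable M"
  shows "(\<lambda>x. \<lambda>i\<in>{..<n}. f x i) \<in> measurable M (lebesgue_n n)"
  unfolding lebesgue_n_def using assms by (intro measurable_restrict) auto

lemma measurable_vec_dist [measurable (raw)]:
  assumes "f \<in> measurable M (lebesgue_n n)" "g \<in> measurable M (lebesgue_n n)"
  shows "(\<lambda>x. vec_dist n (f x) (g x)) \<in> borel_measurable M"
  unfolding vec_dist_def using assms by measurable

lemma measurable_vec_diff [measurable (raw)]:
  assumes "f \<in> measurable M (lebesgue_n n)" "g \<in> measurable M (lebesgue_n n)"
  shows "(\<lambda>x. vec_diff n (f x) (g x)) \<in> measurable M (lebesgue_n n)"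
  unfolding vec_diff_def using assms
  by (intro measurable_lebesgue_n_restrict borel_measurable_diff measurable_lebesgue_n_component)

lemma vec_dist_L2: "vec_dist n x y = L2_set (\<lambda>i. x i - y i) {..<n}"
  by (simp add: vec_dist_def L2_set_def)

lemma vec_dist_triangle: "vec_dist n x z \<le> vec_dist n x y + vec_dist n y z"
  using L2_set_triangle_ineq[of "\<lambda>i. x i - y i" "\<lambda>i. y i - z i" "{..<n}"]
  by (simp add: vec_dist_L2)

lemma vec_dist_commute: "vec_dist n x y = vec_dist n y x"
  by (simp add: vec_dist_def power2_commute)

lemma vec_dist_nonneg [simp]: "0 \<le> vec_dist n x y"
  by (simp add: vec_dist_def sum_nonneg)

lemma vec_eq_iff_dist:
  assumes "x \<in> space (lebesgue_n n)" "y \<in> space (lebesgue_n n)"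
  shows "x = y \<longleftrightarrow> vec_dist n x y = 0"
  using assms by (auto simp: vec_dist_def sum_nonneg_eq_0_iff space_lebesgue_n intro: extensionalityI)

definition vec_ball :: "nat \<Rightarrow> vec \<Rightarrow> real \<Rightarrow> vec set" where
  "vec_ball n c r = {y \<in> space (lebesgue_n n). vec_dist n y c \<le> r}"

lemma sets_vec_ball [measurable]: "vec_ball n c r \<in> sets (lebesgue_n n)"
  unfolding vec_ball_def vec_dist_def by measurable

section \<open>Translation invariance and the volume of a ball\<close>

definition translate :: "nat \<Rightarrow> vec \<Rightarrow> vec \<Rightarrow> vec" where
  "translate n c x = (\<lambda>i\<in>{..<n}. x i + c i)"

lemma measurable_translate [measurable]: "translate n c \<in> measurable (lebesgue_n n) (lebesgue_n n)"
  unfolding translate_def by (intro measurable_lebesgue_n_restrict) measurable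

lemma distr_translate: "distr (lebesgue_n n) (lebesgue_n n) (translate n c) = lebesgue_n n"
proof -
  have "distr (lebesgue_n n) (lebesgue_n n) (translate n c) = (\<Pi>\<^sub>M i\<in>{..<n}. lborel)"
  proof (rule lborel_product.PiM_eqI)
    fix A :: "nat \<Rightarrow> real set"
    assume A: "\<And>i. i \<in> {..<n} \<Longrightarrow> A i \<in> sets lborel"
    define B where "B i = (\<lambda>x. x + c i) -` A i" for i
    have B: "B i \<in> sets lborel" if "i \<in> {..<n}" for i
      using measurable_sets[of "\<lambda>x. x + c i" lborel lborel "A i"] A[OF that] by (simp add: B_def)
    have eq: "translate n c -` Pi\<^sub>E {..<n} A \<inter> space (lebesgue_n n) = Pi\<^sub>E {..<n} B"
      by (auto simp: translate_def B_def space_lebesgue_n PiE_def Pi_def)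
    have "emeasure lborel (B i) = emeasure lborel (A i)" if "i \<in> {..<n}" for i
    proof -
      have "emeasure (distr lborel borel ((+) (c i))) (A i) = emeasure lborel (B i)"
        using A[OF that] by (subst emeasure_distr) (auto simp: B_def add.commute[of _ "c i"])
      then show ?thesis
        by (metis lborel_distr_plus)
    qed
    moreover have "Pi\<^sub>E {..<n} A \<in> sets (lebesgue_n n)"
      unfolding lebesgue_n_def using A by (intro sets_PiM_I_finite) auto
    ultimately show "emeasure (distr (lebesgue_n n) (lebesgue_n n) (translate n c)) (Pi\<^sub>E {..<n} A) =
        (\<Prod>i\<in>{..<n}. emeasure lborel (A i))"
      using B lborel_product.emeasure_PiM[of "{..<n}" B]
      by (simp add: emeasure_distr eq) (simp add: lebesgue_n_def)
  qed (auto simp: lebesgue_n_def)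
  then show ?thesis by (simp add: lebesgue_n_def)
qed

lemma emeasure_vec_ball:
  assumes "r \<ge> 0" "n \<ge> 1"
  shows "emeasure (lebesgue_n n) (vec_ball n c r) = ennreal (unit_ball_vol n * r ^ n)"
proof -
  have pos: "emeasure (lebesgue_n n) (vec_ball n c r) = ennreal (unit_ball_vol n * r ^ n)" if "r > 0" for r
  proof -
    have *: "translate n c -` vec_ball n c r \<inter> space (lebesgue_n n)
        = {f. sqrt (\<Sum>i<n. (f i)\<^sup>2) \<le> r} \<inter> space (lebesgue_n n)"
      using measurable_space[OF measurable_translate[of n c]]
      by (auto simp: vec_ball_def vec_dist_def translate_def)
    have "emeasure (lebesgue_n n) (vec_ball n c r)
        = emeasure (distr (lebesgue_n n) (lebesgue_n n) (translate n c)) (vec_ball n c r)"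
      by (simp add: distr_translate)
    also have "\<dots> = emeasure (lebesgue_n n) ({f. sqrt (\<Sum>i<n. (f i)\<^sup>2) \<le> r} \<inter> space (lebesgue_n n))"
      by (subst emeasure_distr) (auto simp: *)
    also have "\<dots> = ennreal (unit_ball_vol n * r ^ n)"
      using emeasure_cball_aux[of "{..<n}" r] that by (simp add: lebesgue_n_def)
    finally show ?thesis .
  qed
  show ?thesis
  proof (cases "r > 0")
    \<comment> \<open>Radius 0: this ball lies in balls of every positive radius, whose volumes tend
      to 0 because \<open>n \<ge> 1\<close>.\<close>
    case False
    have "emeasure (lebesgue_n n) (vec_ball n c 0) \<le> ennreal (unit_ball_vol n * \<epsilon> ^ n)" if "\<epsilon> > 0" for \<epsilon>
    proof -
      have "vec_ball n c 0 \<subseteq> vec_ball n c \<epsilon>"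
        using that by (auto simp: vec_ball_def)
      from emeasure_mono[OF this, of "lebesgue_n n"] show ?thesis
        by (simp add: pos[OF that])
    qed
    note bd = this
    have "((\<lambda>\<epsilon>. ennreal (unit_ball_vol n * \<epsilon> ^ n)) \<longlongrightarrow> ennreal (unit_ball_vol n * 0 ^ n)) (at_right 0)"
      by (intro tendsto_intros)
    then have "emeasure (lebesgue_n n) (vec_ball n c 0) \<le> ennreal (unit_ball_vol n * 0 ^ n)"
      by (rule tendsto_lowerbound) (auto simp: eventually_at_right_less bd intro!: eventually_at_right_less[THEN eventually_mono])
    moreover have "r = 0" "(0::real) ^ n = 0"
      using False assms by auto
    ultimately show ?thesis
      by simp
  qed (use pos in auto)
qed

section \<open>The grid of cells of side \<open>1 / m\<close>\<close>

definition cell :: "nat \<Rightarrow> nat \<Rightarrow> (nat \<Rightarrow> nat) \<Rightarrow> vec set" where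
  "cell n m z = (\<Pi>\<^sub>E i\<in>{..<n}. {real (z i) / real m ..< real (z i + 1) / real m})"

definition corner :: "nat \<Rightarrow> nat \<Rightarrow> (nat \<Rightarrow> nat) \<Rightarrow> vec" where
  "corner n m z = (\<lambda>i\<in>{..<n}. real (z i) / real m)"

lemma sets_cell [measurable]: "cell n m z \<in> sets (lebesgue_n n)"
  unfolding cell_def lebesgue_n_def by (intro sets_PiM_I_finite) auto

lemma emeasure_cell:
  assumes "m > 0" shows "emeasure (lebesgue_n n) (cell n m z) = ennreal ((1 / real m) ^ n)"
proof -
  have "emeasure (lebesgue_n n) (cell n m z)
      = (\<Prod>i<n. emeasure lborel {real (z i) / real m ..< real (z i + 1) / real m})"
    unfolding cell_def lebesgue_n_def by (intro lborel_product.emeasure_PiM) auto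
  also have "\<dots> = (\<Prod>i<n. ennreal (1 / real m))"
    using assms by (intro prod.cong) (auto simp: divide_right_mono diff_divide_distrib[symmetric])
  finally show ?thesis by (simp add: ennreal_power)
qed

lemma unit_cube_eq_cell: "unit_cube n = cell n 1 (\<lambda>_. 0)"
  by (simp add: unit_cube_def cell_def)

lemma sets_unit_cube [measurable]: "unit_cube n \<in> sets (lebesgue_n n)"
  by (simp add: unit_cube_eq_cell)

lemma mem_cell_iff:
  assumes "m > 0"
  shows "x \<in> cell n m z \<longleftrightarrow> x \<in> extensional {..<n} \<and> (\<forall>i<n. \<lfloor>x i * real m\<rfloor> = int (z i))"
  using assms by (auto simp: cell_def PiE_iff floor_eq_iff field_simps)

text \<open>Half-open cells tile the cube exactly, and the floors in \<open>mem_cell_iff\<close>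
  single out the one that contains a given point. As an identity of indicators, the partition can be
  summed over the points of the process.\<close>

lemma unit_cube_indicator_cells:
  assumes "m > 0"
  shows "indicator (unit_cube n) x
    = (\<Sum>z \<in> {..<n} \<rightarrow>\<^sub>E {..<m}. indicator (cell n m z) x :: ennreal)"
proof (cases "x \<in> unit_cube n")
  case True
  define w where "w = (\<lambda>i\<in>{..<n}. nat \<lfloor>x i * real m\<rfloor>)"
  have x: "0 \<le> x i" "x i < 1" if "i < n" for i
    using True that by (auto simp: unit_cube_def PiE_iff)
  have w: "w \<in> {..<n} \<rightarrow>\<^sub>E {..<m}"
    using x assms by (auto simp: w_def nat_less_iff floor_less_iff)
  have "x \<in> cell n m z \<longleftrightarrow> z = w" if "z \<in> {..<n} \<rightarrow>\<^sub>E {..<m}" for z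
  proof
    assume "x \<in> cell n m z"
    then show "z = w"
      using that assms by (intro extensionalityI[of _ "{..<n}"]) (auto simp: mem_cell_iff w_def PiE_iff)
  next
    assume "z = w"
    then show "x \<in> cell n m z"
      using True x assms by (auto simp: mem_cell_iff w_def unit_cube_def PiE_iff)
  qed
  then have "(\<Sum>z \<in> {..<n} \<rightarrow>\<^sub>E {..<m}. indicator (cell n m z) x :: ennreal)
      = (\<Sum>z \<in> {..<n} \<rightarrow>\<^sub>E {..<m}. if z = w then 1 else 0)"
    by (intro sum.cong) (auto simp: indicator_def)
  also have "\<dots> = 1"
    using w by (simp add: finite_PiE)
  finally show ?thesis using True by simp
next
  case False
  have "x \<notin> cell n m z" if "z \<in> {..<n} \<rightarrow>\<^sub>E {..<m}" for z
  proof
    assume x: "x \<in> cell n m z"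
    have "0 \<le> x i \<and> x i < 1" if "i < n" for i
    proof -
      have "real (z i) / real m \<le> x i" "x i < real (z i + 1) / real m"
        using x that by (auto simp: cell_def PiE_iff)
      moreover have "z i + 1 \<le> m"
        using that \<open>z \<in> _\<close> by (auto simp: PiE_iff Suc_le_eq)
      then have "real (z i + 1) / real m \<le> 1" using assms by (simp add: field_simps)
      moreover have "0 \<le> real (z i) / real m" by simp
      ultimately show ?thesis by linarith
    qed
    with x False show False by (auto simp: cell_def unit_cube_def PiE_iff)
  qed
  then show ?thesis using False by (simp add: indicator_def)
qed

text \<open>Allows the random centre of an error ball to be replaced by a fixed one, at a price that
  vanishes as \<open>m\<close> grows.\<close>

lemma vec_dist_cell:
  assumes "m > 0" "x \<in> cell n m z"
  shows "vec_dist n x (corner n m z) \<le> sqrt (real n) / real m"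
proof -
  have "(x i - corner n m z i)\<^sup>2 \<le> (1 / real m)\<^sup>2" if "i < n" for i
  proof (rule power_mono)
    show "x i - corner n m z i \<le> 1 / real m" "0 \<le> x i - corner n m z i"
      using assms that by (auto simp: cell_def corner_def PiE_iff add_divide_distrib Ball_def algebra_simps)
  qed
  then have "(\<Sum>i<n. (x i - corner n m z i)\<^sup>2) \<le> real n * (1 / real m)\<^sup>2"
    by (intro sum_bounded_above[of "{..<n}", simplified]) auto
  then have "vec_dist n x (corner n m z) \<le> sqrt (real n * (1 / real m)\<^sup>2)"
    unfolding vec_dist_def by (rule real_sqrt_le_mono)
  also have "\<dots> = sqrt (real n) / real m"
    by (simp add: real_sqrt_mult real_sqrt_divide)
  finally show ?thesis .
qed

section \<open>Counts of a Poisson process\<close>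

lemma emeasure_point_process:
  assumes "\<And>k. T k \<omega> \<in> space (lebesgue_n n)" "B \<in> sets (lebesgue_n n)"
  shows "emeasure (point_process n T \<omega>) B = (\<Sum>k. indicator B (T k \<omega>))"
proof -
  have "emeasure (point_process n T \<omega>) B
      = emeasure (count_space UNIV) ((\<lambda>k. T k \<omega>) -` B \<inter> space (count_space UNIV))"
    unfolding point_process_def using assms by (intro emeasure_distr) auto
  also have "\<dots> = (\<integral>\<^sup>+k. indicator ((\<lambda>k. T k \<omega>) -` B) k \<partial>count_space UNIV)"
    by simp
  also have "\<dots> = (\<Sum>k. indicator B (T k \<omega>))"
    by (subst nn_integral_count_space_nat) (intro suminf_cong, simp add: indicator_def)
  finally show ?thesis .
qed

lemma poisson_weight_sums: "(\<lambda>j. exp (- l) * l ^ j / fact j) sums (1::real)"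
proof -
  have "(\<lambda>j. exp (- l) * (l ^ j /\<^sub>R fact j)) sums (exp (- l) * exp l)"
    by (intro sums_mult exp_converges)
  then show ?thesis by (simp add: exp_minus field_simps)
qed

lemma poisson_mean_sums: "(\<lambda>j. real j * (exp (- l) * l ^ j / fact j)) sums (l::real)"
proof -
  have "(\<lambda>j. l * (exp (- l) * l ^ j / fact j)) sums (l * 1)"
    by (intro sums_mult poisson_weight_sums)
  also have "(\<lambda>j. l * (exp (- l) * l ^ j / fact j))
      = (\<lambda>j. real (Suc j) * (exp (- l) * l ^ Suc j / fact (Suc j)))"
    by (auto simp: fun_eq_iff divide_simps)
  finally show ?thesis
    by (subst (asm) sums_Suc_iff) simp
qed

locale poisson_points = prob_space M for M :: "'a measure" +
  fixes n :: nat and \<Lambda> :: real and T :: "nat \<Rightarrow> 'a \<Rightarrow> vec"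
  assumes \<Lambda>_pos: "\<Lambda> > 0" and n_pos: "n \<ge> 1"
    and T_measurable [measurable]: "\<And>k. T k \<in> measurable M (lebesgue_n n)"
    and poisson: "homogeneous_poisson M n \<Lambda> (point_process n T)"
begin

definition num :: "vec set \<Rightarrow> 'a \<Rightarrow> ennreal" where
  "num B \<omega> = emeasure (point_process n T \<omega>) B"

lemma T_space: "\<omega> \<in> space M \<Longrightarrow> T k \<omega> \<in> space (lebesgue_n n)"
  by (rule measurable_space[OF T_measurable])

lemma num_eq_suminf:
  "\<omega> \<in> space M \<Longrightarrow> B \<in> sets (lebesgue_n n) \<Longrightarrow> num B \<omega> = (\<Sum>k. indicator B (T k \<omega>))"
  unfolding num_def by (intro emeasure_point_process T_space)

lemma measurable_num [measurable]:
  "B \<in> sets (lebesgue_n n) \<Longrightarrow> num B \<in> borel_measurable M"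
  using poisson unfolding homogeneous_poisson_def num_def[abs_def] by blast

lemma one_le_num:
  assumes "\<omega> \<in> space M" "B \<in> sets (lebesgue_n n)" "T k \<omega> \<in> B"
  shows "1 \<le> num B \<omega>"
  using sum_le_suminf[of "\<lambda>k. indicator B (T k \<omega>) :: ennreal" "{k}"] assms
  by (simp add: num_eq_suminf)

lemma one_le_num_obtain:
  assumes "\<omega> \<in> space M" "B \<in> sets (lebesgue_n n)" "1 \<le> num B \<omega>"
  obtains k where "T k \<omega> \<in> B"
proof -
  have "\<exists>k. T k \<omega> \<in> B"
  proof (rule ccontr)
    assume "\<not> (\<exists>k. T k \<omega> \<in> B)"
    then have "num B \<omega> = 0"
      using assms by (simp add: num_eq_suminf)
    with assms(3) show False by simp
  qed
  then show ?thesis using that by blast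
qed

lemma two_le_num:
  assumes "\<omega> \<in> space M" "B \<in> sets (lebesgue_n n)" "T k \<omega> \<in> B" "T j \<omega> \<in> B" "j \<noteq> k"
  shows "2 \<le> num B \<omega>"
  using sum_le_suminf[of "\<lambda>k. indicator B (T k \<omega>) :: ennreal" "{j, k}"] assms
  by (simp add: num_eq_suminf)

lemma prob_num_eq:
  assumes B: "B \<in> sets (lebesgue_n n)" "emeasure (lebesgue_n n) B = ennreal b" "b \<ge> 0"
  shows "prob {\<omega> \<in> space M. num B \<omega> = of_nat j} = exp (- (\<Lambda> * b)) * (\<Lambda> * b) ^ j / fact j"
proof -
  have "measure (lebesgue_n n) B = b" using B by (simp add: measure_def)
  then show ?thesis
    using poisson B unfolding homogeneous_poisson_def num_def by auto
qed

text \<open>The prescribed probabilities of the values 0, 1, 2, ... already sum to 1, which leaves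
  no mass for an infinite count.\<close>

lemma AE_num_nat:
  assumes B: "B \<in> sets (lebesgue_n n)" "emeasure (lebesgue_n n) B = ennreal b" "b \<ge> 0"
  shows "AE \<omega> in M. \<exists>j::nat. num B \<omega> = of_nat j"
proof -
  note [measurable] = B(1)
  define E where "E j = {\<omega> \<in> space M. num B \<omega> = of_nat j}" for j :: nat
  have [measurable]: "E j \<in> events" for j unfolding E_def by measurable
  have "(\<lambda>j. prob (E j)) sums prob (\<Union>j. E j)"
    by (intro finite_measure_UNION) (auto simp: disjoint_family_on_def E_def)
  moreover have "(\<lambda>j. prob (E j)) sums 1"
    using poisson_weight_sums[of "\<Lambda> * b"] prob_num_eq[OF B] by (simp add: E_def)
  ultimately have "prob (\<Union>j. E j) = 1"
    by (rule sums_unique2)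
  then have "AE \<omega> in M. \<omega> \<in> (\<Union>j. E j)"
    by (intro AE_prob_1)
  then show ?thesis by eventually_elim (auto simp: E_def)
qed

text \<open>Splitting over the values of the count turns an expectation into a Poisson series;
  \<open>f\<close> will be the identity, the test for occupancy, and the identity cut off below
  2.\<close>

lemma nn_integral_num:
  assumes B: "B \<in> sets (lebesgue_n n)" "emeasure (lebesgue_n n) B = ennreal b" "b \<ge> 0"
    and f: "f \<in> borel_measurable borel"
  shows "(\<integral>\<^sup>+\<omega>. f (num B \<omega>) \<partial>M)
    = (\<Sum>j. f (of_nat j) * ennreal (exp (- (\<Lambda> * b)) * (\<Lambda> * b) ^ j / fact j))"
proof -
  note [measurable] = B(1)
  define E where "E j = {\<omega> \<in> space M. num B \<omega> = of_nat j}" for j :: nat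
  have [measurable]: "E j \<in> events" for j unfolding E_def by measurable
  have "(\<integral>\<^sup>+\<omega>. f (num B \<omega>) \<partial>M) = (\<integral>\<^sup>+\<omega>. (\<Sum>j. f (of_nat j) * indicator (E j) \<omega>) \<partial>M)"
  proof (rule nn_integral_cong_AE)
    have "f (num B \<omega>) = (\<Sum>j. f (of_nat j) * indicator (E j) \<omega>)"
      if "\<omega> \<in> space M" "num B \<omega> = of_nat i" for \<omega> i
    proof -
      have "(\<Sum>j. f (of_nat j) * indicator (E j) \<omega>)
          = (\<Sum>j\<in>{i}. f (of_nat j) * indicator (E j) \<omega>)"
        using that by (intro suminf_finite) (auto simp: E_def)
      then show ?thesis using that by (simp add: E_def)
    qed
    then show "AE \<omega> in M. f (num B \<omega>) = (\<Sum>j. f (of_nat j) * indicator (E j) \<omega>)"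
      using AE_num_nat[OF B] by (elim AE_mp) (auto intro!: AE_I2)
  qed
  also have "\<dots> = (\<Sum>j. \<integral>\<^sup>+\<omega>. f (of_nat j) * indicator (E j) \<omega> \<partial>M)"
    by (intro nn_integral_suminf) auto
  also have "\<dots> = (\<Sum>j. f (of_nat j) * emeasure M (E j))"
    by (simp add: nn_integral_cmult_indicator)
  finally show ?thesis
    using prob_num_eq[OF B] by (simp add: emeasure_eq_measure E_def)
qed

lemma nn_integral_num_id:
  assumes B: "B \<in> sets (lebesgue_n n)" "emeasure (lebesgue_n n) B = ennreal b" "b \<ge> 0"
  shows "(\<integral>\<^sup>+\<omega>. num B \<omega> \<partial>M) = ennreal (\<Lambda> * b)"
proof -
  define p where "p j = exp (- (\<Lambda> * b)) * (\<Lambda> * b) ^ j / fact j" for j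
  have p: "p j \<ge> 0" for j using \<Lambda>_pos B(3) by (simp add: p_def)
  have "(\<integral>\<^sup>+\<omega>. num B \<omega> \<partial>M) = (\<Sum>j. ennreal (real j * p j))"
    by (subst nn_integral_num[OF B, of "\<lambda>x. x"])
      (auto simp: p ennreal_mult ennreal_of_nat_eq_real_of_nat p_def[symmetric])
  also have "\<dots> = ennreal (\<Lambda> * b)"
    using poisson_mean_sums[of "\<Lambda> * b"] by (intro suminf_ennreal_eq) (auto simp: p p_def[symmetric])
  finally show ?thesis .
qed

lemma nn_integral_num_ge_one:
  assumes B: "B \<in> sets (lebesgue_n n)" "emeasure (lebesgue_n n) B = ennreal b" "b \<ge> 0"
  shows "(\<integral>\<^sup>+\<omega>. (if 1 \<le> num B \<omega> then 1 else 0) \<partial>M) = ennreal (1 - exp (- (\<Lambda> * b)))"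
proof -
  define p where "p j = exp (- (\<Lambda> * b)) * (\<Lambda> * b) ^ j / fact j" for j
  have p: "p j \<ge> 0" for j using \<Lambda>_pos B(3) by (simp add: p_def)
  have one: "1 \<le> (of_nat j :: ennreal) \<longleftrightarrow> 1 \<le> j" for j
    by (metis of_nat_le_iff of_nat_1)
  have "(\<lambda>j. p j - (if j = 0 then p j else 0)) sums (1 - p 0)"
    using poisson_weight_sums[of "\<Lambda> * b"] by (intro sums_diff sums_single) (simp add: p_def)
  moreover have "p j - (if j = 0 then p j else 0) = (if 1 \<le> j then p j else 0)" for j
    by (cases j) auto
  ultimately have s: "(\<lambda>j. if 1 \<le> j then p j else 0) sums (1 - exp (- (\<Lambda> * b)))"
    by (simp add: p_def)
  have "(\<integral>\<^sup>+\<omega>. (if 1 \<le> num B \<omega> then 1 else 0) \<partial>M) = (\<Sum>j. ennreal (if 1 \<le> j then p j else 0))"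
    by (subst nn_integral_num[OF B, of "\<lambda>x. if 1 \<le> x then 1 else 0"])
       (auto intro!: suminf_cong simp: one p_def[symmetric])
  also have "\<dots> = ennreal (1 - exp (- (\<Lambda> * b)))"
    using s by (intro suminf_ennreal_eq) (auto simp: p)
  finally show ?thesis .
qed

text \<open>With l = \<open>\<Lambda> * b\<close> the integral is l - l exp(-l) = l (1 - exp(-l)). A
  quadratic bound is what makes multiply occupied cells negligible: there are \<open>m ^ n\<close>
  cells, each of volume \<open>(1 / m) ^ n\<close>.\<close>

lemma nn_integral_num_ge_two_le:
  assumes B: "B \<in> sets (lebesgue_n n)" "emeasure (lebesgue_n n) B = ennreal b" "b \<ge> 0"
  shows "(\<integral>\<^sup>+\<omega>. (if 2 \<le> num B \<omega> then num B \<omega> else 0) \<partial>M) \<le> ennreal ((\<Lambda> * b)\<^sup>2)"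
proof -
  define p where "p j = exp (- (\<Lambda> * b)) * (\<Lambda> * b) ^ j / fact j" for j
  have p: "p j \<ge> 0" for j using \<Lambda>_pos B(3) by (simp add: p_def)
  have two: "2 \<le> (of_nat j :: ennreal) \<longleftrightarrow> 2 \<le> j" for j
    by (metis of_nat_le_iff of_nat_numeral)
  have "(\<lambda>j. real j * p j - (if j = 1 then p j else 0)) sums (\<Lambda> * b - p 1)"
    using poisson_mean_sums[of "\<Lambda> * b"] by (intro sums_diff sums_single) (simp add: p_def)
  moreover have "real j * p j - (if j = 1 then p j else 0) = (if 2 \<le> j then real j * p j else 0)" for j
    by (cases "j = 0") auto
  ultimately have s: "(\<lambda>j. if 2 \<le> j then real j * p j else 0) sums (\<Lambda> * b - p 1)"
    by simp
  have "(\<integral>\<^sup>+\<omega>. (if 2 \<le> num B \<omega> then num B \<omega> else 0) \<partial>M)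
      = (\<Sum>j. ennreal (if 2 \<le> j then real j * p j else 0))"
    by (subst nn_integral_num[OF B, of "\<lambda>x. if 2 \<le> x then x else 0"])
      (auto intro!: suminf_cong simp: two p ennreal_mult ennreal_of_nat_eq_real_of_nat p_def[symmetric])
  also have "\<dots> = ennreal (\<Lambda> * b - p 1)"
    using s by (intro suminf_ennreal_eq) (auto simp: p)
  also have "\<dots> \<le> ennreal ((\<Lambda> * b)\<^sup>2)"
  proof (rule ennreal_leI)
    have "\<Lambda> * b * (1 - exp (- (\<Lambda> * b))) \<le> \<Lambda> * b * (\<Lambda> * b)"
      using \<Lambda>_pos B(3) exp_ge_add_one_self[of "- (\<Lambda> * b)"] by (intro mult_left_mono) auto
    then show "\<Lambda> * b - p 1 \<le> (\<Lambda> * b)\<^sup>2"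
      by (simp add: p_def power2_eq_square algebra_simps)
  qed
  finally show ?thesis .
qed

lemma nn_integral_num_indep:
  assumes B: "A \<in> sets (lebesgue_n n)" "B \<in> sets (lebesgue_n n)" "A \<inter> B = {}"
    and f: "f \<in> borel_measurable borel" and g: "g \<in> borel_measurable borel"
  shows "(\<integral>\<^sup>+\<omega>. f (num A \<omega>) * g (num B \<omega>) \<partial>M)
    = (\<integral>\<^sup>+\<omega>. f (num A \<omega>) \<partial>M) * (\<integral>\<^sup>+\<omega>. g (num B \<omega>) \<partial>M)"
proof -
  define S where "S i = (if i = (0::nat) then A else B)" for i
  have "indep_vars (\<lambda>_. borel) (\<lambda>i. num (S i)) {0, 1::nat}"
  proof -
    have "finite {0, 1::nat}" "S ` {0, 1} \<subseteq> sets (lebesgue_n n)" "disjoint_family_on S {0, 1}"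
      using B by (auto simp: S_def disjoint_family_on_def)
    with poisson show ?thesis
      unfolding homogeneous_poisson_def num_def[abs_def] by blast
  qed
  then have "indep_vars (\<lambda>_. borel) (\<lambda>i \<omega>. (if i = 0 then f else g) (num (S i) \<omega>)) {0, 1::nat}"
    by (rule indep_vars_compose2) (use f g in auto)
  from indep_vars_nn_integral[OF _ this] show ?thesis
    by (simp add: S_def)
qed

end

section \<open>Decoding errors for a fixed displacement\<close>

definition vec_norm :: "nat \<Rightarrow> vec \<Rightarrow> real" where
  "vec_norm n x = sqrt (\<Sum>i<n. (x i)\<^sup>2)"

lemma vec_norm_nonneg [simp]: "0 \<le> vec_norm n x"
  by (simp add: vec_norm_def sum_nonneg)

lemma measurable_vec_norm [measurable (raw)]:
  assumes "f \<in> measurable M (lebesgue_n n)"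
  shows "(\<lambda>x. vec_norm n (f x)) \<in> borel_measurable M"
  unfolding vec_norm_def using assms by measurable

text \<open>Carries a comparison in the recentred configuration back to the original one, where the
  ball around the displaced point appears.\<close>

lemma vec_dist_vec_diff: "vec_dist n d (vec_diff n x y) = vec_dist n x (translate n d y)"
  unfolding vec_dist_def vec_diff_def translate_def
  by (intro arg_cong[where f = sqrt] sum.cong) (auto simp: power2_eq_square algebra_simps)

lemma vec_dist_vec_diff_self: "vec_dist n d (vec_diff n x x) = vec_norm n d"
  by (simp add: vec_dist_def vec_norm_def vec_diff_def)

lemma vec_dist_translate: "vec_dist n (translate n d x) (translate n d y) = vec_dist n x y"
  by (simp add: vec_dist_def translate_def)

text \<open>A displacement by \<open>d\<close> makes the point \<open>t k\<close> be decoded wrongly: its Voronoi cell is open,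
  so that ties count as errors.\<close>

definition confusable :: "nat \<Rightarrow> (nat \<Rightarrow> vec) \<Rightarrow> vec \<Rightarrow> nat \<Rightarrow> bool" where
  "confusable n t d k \<longleftrightarrow> (\<exists>j. t j \<noteq> t k \<and>
     vec_dist n d (vec_diff n (t j) (t k)) \<le> vec_dist n d (vec_diff n (t k) (t k)))"

lemma confusable_iff:
  "confusable n t d k \<longleftrightarrow> (\<exists>j. t j \<noteq> t k \<and> vec_dist n (t j) (translate n d (t k)) \<le> vec_norm n d)"
  by (simp add: confusable_def vec_dist_vec_diff_self) (simp add: vec_dist_vec_diff)

text \<open>Equality is expressed as distance zero, which is a measurable condition by
  \<open>measurable_vec_dist\<close>.\<close>

lemma pred_vec_eq:
  assumes [measurable]: "f \<in> measurable M (lebesgue_n n)" "g \<in> measurable M (lebesgue_n n)"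
  shows "Measurable.pred M (\<lambda>x. f x = g x)"
proof -
  have "Measurable.pred M (\<lambda>x. vec_dist n (f x) (g x) = 0)"
    by measurable
  also have "?this \<longleftrightarrow> ?thesis"
    by (intro measurable_cong vec_eq_iff_dist[symmetric] measurable_space[OF assms(1)]
        measurable_space[OF assms(2)])
  finally show ?thesis .
qed

lemma pred_confusable:
  assumes "\<And>j. (\<lambda>x. t x j) \<in> measurable M (lebesgue_n n)"
    and [measurable]: "d \<in> measurable M (lebesgue_n n)"
  shows "Measurable.pred M (\<lambda>x. confusable n (t x) (d x) k)"
proof -
  note [measurable] = assms(1)[of k] assms(1) pred_vec_eq
  show ?thesis unfolding confusable_def by measurable
qed

context poisson_points
begin

text \<open>One deterministic \<open>d\<close> serves for all points: this is the situation after
  the displacements have been frozen.\<close>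

definition confusions :: "vec \<Rightarrow> vec set \<Rightarrow> 'a \<Rightarrow> ennreal" where
  "confusions d B \<omega> = (\<Sum>k. indicator B (T k \<omega>) * (if confusable n (\<lambda>j. T j \<omega>) d k then 1 else 0))"

lemma measurable_confusions [measurable]:
  assumes [measurable]: "B \<in> sets (lebesgue_n n)" "d \<in> space (lebesgue_n n)"
  shows "confusions d B \<in> borel_measurable M"
proof -
  have [measurable]: "Measurable.pred M (\<lambda>\<omega>. confusable n (\<lambda>j. T j \<omega>) d k)" for k
    by (rule pred_confusable) auto
  show ?thesis unfolding confusions_def[abs_def] by measurable
qed

lemma confusions_unit_cube:
  assumes "m > 0"
  shows "confusions d (unit_cube n) \<omega> = (\<Sum>z \<in> {..<n} \<rightarrow>\<^sub>E {..<m}. confusions d (cell n m z) \<omega>)"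
  unfolding confusions_def unit_cube_indicator_cells[OF assms]
  by (simp add: sum_distrib_right suminf_sum)

text \<open>A confusable point of \<open>Q\<close> has a rival in the enlarged ball. If the rival is
  outside \<open>Q\<close>, then \<open>A\<close> is occupied; otherwise \<open>Q\<close> holds two
  points. Removing \<open>Q\<close> from the ball makes the two sets disjoint, hence their counts
  independent.\<close>

lemma confusions_cell_le:
  fixes d :: vec and z :: "nat \<Rightarrow> nat"
  assumes "m > 0" "\<omega> \<in> space M"
  defines "Q \<equiv> cell n m z"
  defines "A \<equiv> vec_ball n (translate n d (corner n m z)) (vec_norm n d + sqrt n / m) - Q"
  shows "confusions d Q \<omega> \<le> num Q \<omega> * (if 1 \<le> num A \<omega> then 1 else 0) + (if 2 \<le> num Q \<omega> then num Q \<omega> else 0)"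
proof -
  have [measurable]: "Q \<in> sets (lebesgue_n n)" "A \<in> sets (lebesgue_n n)"
    by (auto simp: Q_def A_def)
  have le: "confusions d Q \<omega> \<le> num Q \<omega>"
    using assms(2) by (subst num_eq_suminf) (auto simp: confusions_def intro!: suminf_le)
  show ?thesis
  proof (cases "1 \<le> num A \<omega> \<or> 2 \<le> num Q \<omega>")
    case True
    then show ?thesis
    proof
      assume "1 \<le> num A \<omega>"
      then show ?thesis by (auto intro!: add_increasing2 order.trans[OF le])
    next
      assume "2 \<le> num Q \<omega>"
      then show ?thesis by (auto intro!: add_increasing order.trans[OF le])
    qed
  next
    case False
    have "\<not> confusable n (\<lambda>j. T j \<omega>) d k" if k: "T k \<omega> \<in> Q" for k
    proof
      assume "confusable n (\<lambda>j. T j \<omega>) d k"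
      then obtain j where j: "T j \<omega> \<noteq> T k \<omega>"
        "vec_dist n (T j \<omega>) (translate n d (T k \<omega>)) \<le> vec_norm n d"
        by (auto simp: confusable_iff)
      have "vec_dist n (T j \<omega>) (translate n d (corner n m z)) \<le> vec_norm n d + sqrt n / m"
        using vec_dist_triangle[of n "T j \<omega>" "translate n d (corner n m z)" "translate n d (T k \<omega>)"]
          j(2) vec_dist_cell[OF assms(1) k[unfolded Q_def]] vec_dist_translate[of n d "T k \<omega>" "corner n m z"]
        by linarith
      then have "T j \<omega> \<in> A \<or> T j \<omega> \<in> Q"
        using T_space[OF assms(2), of j] by (auto simp: A_def vec_ball_def)
      then show False
        using False one_le_num[of \<omega> A j] two_le_num[of \<omega> Q k j] k assms(2) j(1) by auto
    qed
    then have "confusions d Q \<omega> = (\<Sum>k. 0)"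
      unfolding confusions_def by (intro suminf_cong) (auto simp: indicator_def)
    then show ?thesis by simp
  qed
qed

text \<open>The shrunken ball lies in the error ball of every point of \<open>Q\<close>, and a point
  of \<open>A\<close> differs from any point of \<open>Q\<close>. Only one confusable point of
  \<open>Q\<close> is counted, which is enough since several points in one small cell are
  rare.\<close>

lemma confusions_cell_ge:
  fixes d :: vec and z :: "nat \<Rightarrow> nat"
  assumes "m > 0" "\<omega> \<in> space M"
  defines "Q \<equiv> cell n m z"
  defines "A \<equiv> vec_ball n (translate n d (corner n m z)) (vec_norm n d - sqrt n / m) - Q"
  shows "(if 1 \<le> num Q \<omega> then 1 else 0) * (if 1 \<le> num A \<omega> then 1 else 0) \<le> confusions d Q \<omega>"
proof (cases "1 \<le> num Q \<omega> \<and> 1 \<le> num A \<omega>")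
  case True
  have [measurable]: "Q \<in> sets (lebesgue_n n)" "A \<in> sets (lebesgue_n n)"
    by (auto simp: Q_def A_def)
  obtain k where k: "T k \<omega> \<in> Q"
    using one_le_num_obtain[of \<omega> Q] True assms(2) by auto
  obtain j where j: "T j \<omega> \<in> A"
    using one_le_num_obtain[of \<omega> A] True assms(2) by auto
  have "vec_dist n (T j \<omega>) (translate n d (corner n m z)) \<le> vec_norm n d - sqrt n / m"
    using j by (auto simp: A_def vec_ball_def)
  then have "vec_dist n (T j \<omega>) (translate n d (T k \<omega>)) \<le> vec_norm n d"
    using vec_dist_triangle[of n "T j \<omega>" "translate n d (T k \<omega>)" "translate n d (corner n m z)"]
      vec_dist_cell[OF assms(1) k[unfolded Q_def]] vec_dist_translate[of n d "corner n m z" "T k \<omega>"]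
      vec_dist_commute[of n "corner n m z" "T k \<omega>"]
    by linarith
  moreover have "T j \<omega> \<noteq> T k \<omega>" using j k by (auto simp: A_def)
  ultimately have "confusable n (\<lambda>j. T j \<omega>) d k"
    by (auto simp: confusable_iff)
  then show ?thesis
    using True k sum_le_suminf[of "\<lambda>k. indicator Q (T k \<omega>) * (if confusable n (\<lambda>j. T j \<omega>) d k then 1 else 0) :: ennreal" "{k}"]
    by (simp add: confusions_def)
qed auto

lemma card_cells: "card ({..<n} \<rightarrow>\<^sub>E {..<m::nat}) = m ^ n"
  by (simp add: card_PiE)

lemma nn_integral_confusions_sum:
  assumes "m > 0" and d: "d \<in> space (lebesgue_n n)"
  shows "(\<integral>\<^sup>+\<omega>. confusions d (unit_cube n) \<omega> \<partial>M)
    = (\<Sum>z \<in> {..<n} \<rightarrow>\<^sub>E {..<m}. \<integral>\<^sup>+\<omega>. confusions d (cell n m z) \<omega> \<partial>M)"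
  using assms by (simp add: confusions_unit_cube nn_integral_sum)

text \<open>If \<open>l\<close> is the mean count of a cell and \<open>p\<close> the probability
  that the enlarged ball is occupied, independence bounds the share of a cell by
  \<open>l * p + l\<^sup>2\<close>. There are \<open>m ^ n\<close> cells, and
  \<open>m ^ n * l\<close> is \<open>\<Lambda>\<close>.\<close>

lemma nn_integral_confusions_le:
  assumes m: "m > 0" and d: "d \<in> space (lebesgue_n n)"
  shows "(\<integral>\<^sup>+\<omega>. confusions d (unit_cube n) \<omega> \<partial>M)
    \<le> ennreal (\<Lambda> * (1 - exp (- (\<Lambda> * (unit_ball_vol n * (vec_norm n d + sqrt n / m) ^ n))))
        + \<Lambda>\<^sup>2 * (1 / real m) ^ n)"
proof -
  define l where "l = \<Lambda> * (1 / real m) ^ n"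
  define p where "p = 1 - exp (- (\<Lambda> * (unit_ball_vol n * (vec_norm n d + sqrt n / m) ^ n)))"
  have p: "p \<ge> 0" and l: "l \<ge> 0"
    using \<Lambda>_pos by (auto simp: p_def l_def)
  have cell: "(\<integral>\<^sup>+\<omega>. confusions d (cell n m z) \<omega> \<partial>M) \<le> ennreal (l * p + l\<^sup>2)" for z
  proof -
    define Q where "Q = cell n m z"
    define B where "B = vec_ball n (translate n d (corner n m z)) (vec_norm n d + sqrt n / m)"
    have [measurable]: "Q \<in> sets (lebesgue_n n)" "B \<in> sets (lebesgue_n n)"
      by (auto simp: Q_def B_def)
    have Q: "emeasure (lebesgue_n n) Q = ennreal ((1 / real m) ^ n)"
      using m by (simp add: Q_def emeasure_cell)
    \<comment> \<open>Restoring \<open>Q\<close> only increases the chance of occupancy and yields a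
      set whose volume is known exactly.\<close>
    have "num (B - Q) \<omega> \<le> num B \<omega>" if "\<omega> \<in> space M" for \<omega>
      using poisson that unfolding num_def homogeneous_poisson_def by (intro emeasure_mono) auto
    then have "(\<integral>\<^sup>+\<omega>. (if 1 \<le> num (B - Q) \<omega> then 1 else 0) \<partial>M) \<le> (\<integral>\<^sup>+\<omega>. (if 1 \<le> num B \<omega> then 1 else 0) \<partial>M)"
      by (intro nn_integral_mono) (auto intro: order.trans)
    also have "\<dots> = ennreal p"
      unfolding p_def using n_pos unfolding B_def
      by (intro nn_integral_num_ge_one) (auto intro!: emeasure_vec_ball)
    finally have B: "(\<integral>\<^sup>+\<omega>. (if 1 \<le> num (B - Q) \<omega> then 1 else 0) \<partial>M) \<le> ennreal p" .
    have "(\<integral>\<^sup>+\<omega>. confusions d Q \<omega> \<partial>M)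
      \<le> (\<integral>\<^sup>+\<omega>. num Q \<omega> * (if 1 \<le> num (B - Q) \<omega> then 1 else 0) + (if 2 \<le> num Q \<omega> then num Q \<omega> else 0) \<partial>M)"
      unfolding Q_def B_def using m by (intro nn_integral_mono confusions_cell_le) auto
    also have "\<dots> = (\<integral>\<^sup>+\<omega>. num Q \<omega> * (if 1 \<le> num (B - Q) \<omega> then 1 else 0) \<partial>M)
        + (\<integral>\<^sup>+\<omega>. (if 2 \<le> num Q \<omega> then num Q \<omega> else 0) \<partial>M)"
      by (intro nn_integral_add) measurable
    also have "\<dots> \<le> ennreal l * ennreal p + ennreal (l\<^sup>2)"
    proof (rule add_mono)
      have "(\<integral>\<^sup>+\<omega>. num Q \<omega> * (if 1 \<le> num (B - Q) \<omega> then 1 else 0) \<partial>M)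
          = (\<integral>\<^sup>+\<omega>. num Q \<omega> \<partial>M) * (\<integral>\<^sup>+\<omega>. (if 1 \<le> num (B - Q) \<omega> then 1 else 0) \<partial>M)"
        by (rule nn_integral_num_indep[of Q "B - Q" "\<lambda>x. x" "\<lambda>x. if 1 \<le> x then 1 else 0"]) auto
      then show "(\<integral>\<^sup>+\<omega>. num Q \<omega> * (if 1 \<le> num (B - Q) \<omega> then 1 else 0) \<partial>M) \<le> ennreal l * ennreal p"
        using B nn_integral_num_id[OF _ Q] by (simp add: l_def mult_left_mono)
      show "(\<integral>\<^sup>+\<omega>. (if 2 \<le> num Q \<omega> then num Q \<omega> else 0) \<partial>M) \<le> ennreal (l\<^sup>2)"
        unfolding l_def by (rule nn_integral_num_ge_two_le[OF _ Q]) auto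
    qed
    also have "\<dots> = ennreal (l * p + l\<^sup>2)"
      using p l by (simp add: ennreal_mult)
    finally show ?thesis by (simp add: Q_def)
  qed
  have "(\<integral>\<^sup>+\<omega>. confusions d (unit_cube n) \<omega> \<partial>M) \<le> (\<Sum>z \<in> {..<n} \<rightarrow>\<^sub>E {..<m}. ennreal (l * p + l\<^sup>2))"
    unfolding nn_integral_confusions_sum[OF m d] by (intro sum_mono cell)
  also have "\<dots> = ennreal (real (m ^ n) * (l * p + l\<^sup>2))"
    using p l by (simp add: card_cells ennreal_mult ennreal_of_nat_eq_real_of_nat ennreal_power)
  also have "real (m ^ n) * (l * p + l\<^sup>2) = \<Lambda> * p + \<Lambda>\<^sup>2 * (1 / real m) ^ n"
    using m by (simp add: l_def power2_eq_square field_simps)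
  finally show ?thesis by (simp add: p_def)
qed

text \<open>Two losses occur: taking \<open>Q\<close> out of the ball costs at most the volume
  \<open>(1 / m) ^ n\<close>, and replacing the count of \<open>Q\<close> by its occupancy costs at
  most \<open>l\<^sup>2\<close> per cell. The hypotheses \<open>r\<close> and \<open>v\<close> keep
  the radius and the remaining volume nonnegative.\<close>

lemma nn_integral_confusions_ge:
  assumes m: "m > 0" and d: "d \<in> space (lebesgue_n n)" and r: "sqrt n / m \<le> vec_norm n d"
    and v: "(1 / real m) ^ n \<le> unit_ball_vol n * (vec_norm n d - sqrt n / m) ^ n"
  shows "ennreal ((\<Lambda> - \<Lambda>\<^sup>2 * (1 / real m) ^ n)
      * (1 - exp (- (\<Lambda> * (unit_ball_vol n * (vec_norm n d - sqrt n / m) ^ n - (1 / real m) ^ n)))))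
    \<le> (\<integral>\<^sup>+\<omega>. confusions d (unit_cube n) \<omega> \<partial>M)"
proof -
  define l where "l = \<Lambda> * (1 / real m) ^ n"
  define V where "V = unit_ball_vol n * (vec_norm n d - sqrt n / m) ^ n"
  define p where "p = 1 - exp (- (\<Lambda> * (V - (1 / real m) ^ n)))"
  have p: "p \<ge> 0" and l: "l \<ge> 0"
    using \<Lambda>_pos v by (auto simp: p_def l_def V_def)
  have cell: "ennreal ((1 - exp (- l)) * p) \<le> (\<integral>\<^sup>+\<omega>. confusions d (cell n m z) \<omega> \<partial>M)" for z
  proof -
    define Q where "Q = cell n m z"
    define B where "B = vec_ball n (translate n d (corner n m z)) (vec_norm n d - sqrt n / m)"
    define b where "b = measure (lebesgue_n n) (B - Q)"
    have [measurable]: "Q \<in> sets (lebesgue_n n)" "B \<in> sets (lebesgue_n n)"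
      by (auto simp: Q_def B_def)
    have Q: "emeasure (lebesgue_n n) Q = ennreal ((1 / real m) ^ n)"
      using m by (simp add: Q_def emeasure_cell)
    have B: "emeasure (lebesgue_n n) B = ennreal V"
      unfolding B_def V_def using r n_pos by (intro emeasure_vec_ball) auto
    have "emeasure (lebesgue_n n) (B - Q) \<le> emeasure (lebesgue_n n) B"
      by (intro emeasure_mono) auto
    then have b: "emeasure (lebesgue_n n) (B - Q) = ennreal b"
      unfolding b_def B by (intro emeasure_eq_ennreal_measure) (auto simp: top_unique)
    have "ennreal V \<le> emeasure (lebesgue_n n) ((B - Q) \<union> Q)"
      unfolding B[symmetric] by (intro emeasure_mono) auto
    also have "\<dots> \<le> ennreal b + ennreal ((1 / real m) ^ n)"
      unfolding b[symmetric] Q[symmetric] by (intro emeasure_subadditive) auto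
    also have "\<dots> = ennreal (b + (1 / real m) ^ n)"
      by (subst ennreal_plus) (auto simp: b_def)
    finally have "V \<le> b + (1 / real m) ^ n"
      by (subst (asm) ennreal_le_iff) (auto simp: b_def intro!: add_nonneg_nonneg)
    then have pb: "p \<le> 1 - exp (- (\<Lambda> * b))"
      using \<Lambda>_pos by (auto simp: p_def)
    have "ennreal ((1 - exp (- l)) * p) \<le> ennreal (1 - exp (- l)) * ennreal (1 - exp (- (\<Lambda> * b)))"
      using p l pb by (subst ennreal_mult'[symmetric]) (auto intro!: ennreal_leI mult_left_mono)
    also have "\<dots> = (\<integral>\<^sup>+\<omega>. (if 1 \<le> num Q \<omega> then 1 else 0) \<partial>M) * (\<integral>\<^sup>+\<omega>. (if 1 \<le> num (B - Q) \<omega> then 1 else 0) \<partial>M)"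
      using nn_integral_num_ge_one[OF _ Q] nn_integral_num_ge_one[OF _ b] by (simp add: l_def b_def)
    also have "\<dots> = (\<integral>\<^sup>+\<omega>. (if 1 \<le> num Q \<omega> then 1 else 0) * (if 1 \<le> num (B - Q) \<omega> then 1 else 0) \<partial>M)"
      by (rule nn_integral_num_indep[of Q "B - Q" "\<lambda>x. if 1 \<le> x then 1 else 0" "\<lambda>x. if 1 \<le> x then 1 else 0", symmetric]) auto
    also have "\<dots> \<le> (\<integral>\<^sup>+\<omega>. confusions d Q \<omega> \<partial>M)"
      unfolding Q_def B_def using m by (intro nn_integral_mono confusions_cell_ge) auto
    finally show ?thesis by (simp add: Q_def)
  qed
  \<comment> \<open>Compares the probability that a cell is occupied with its mean count
    \<open>l\<close>; the error is of second order, so its sum over all cells vanishes in the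
    limit.\<close>
  have "l - l\<^sup>2 \<le> 1 - exp (- l)"
  proof -
    have "l / (1 + l) \<le> 1 - exp (- l)"
      using exp_ge_add_one_self[of l] l by (simp add: exp_minus field_simps)
    moreover have "l - l\<^sup>2 \<le> l / (1 + l)"
      using l by (simp add: field_simps power2_eq_square)
    ultimately show ?thesis by linarith
  qed
  then have "(l - l\<^sup>2) * p \<le> (1 - exp (- l)) * p"
    using p by (rule mult_right_mono)
  then have "real (m ^ n) * ((l - l\<^sup>2) * p) \<le> real (m ^ n) * ((1 - exp (- l)) * p)"
    by (rule mult_left_mono) auto
  also have "real (m ^ n) * ((l - l\<^sup>2) * p) = (\<Lambda> - \<Lambda>\<^sup>2 * (1 / real m) ^ n) * p"
    using m by (simp add: l_def power2_eq_square field_simps)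
  finally have "ennreal ((\<Lambda> - \<Lambda>\<^sup>2 * (1 / real m) ^ n) * p) \<le> ennreal (real (m ^ n) * ((1 - exp (- l)) * p))"
    by (rule ennreal_leI)
  also have "\<dots> = (\<Sum>z \<in> {..<n} \<rightarrow>\<^sub>E {..<m}. ennreal ((1 - exp (- l)) * p))"
    using p l by (simp add: card_cells ennreal_mult ennreal_of_nat_eq_real_of_nat ennreal_power)
  also have "\<dots> \<le> (\<integral>\<^sup>+\<omega>. confusions d (unit_cube n) \<omega> \<partial>M)"
    unfolding nn_integral_confusions_sum[OF m d] by (intro sum_mono cell)
  finally show ?thesis by (simp add: p_def V_def)
qed

text \<open>Both cell bounds converge to the same value as \<open>m\<close> tends to infinity, since
  \<open>n\<close> and \<open>d\<close> are fixed.\<close>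

lemma nn_integral_confusions:
  assumes d: "d \<in> space (lebesgue_n n)"
  shows "(\<integral>\<^sup>+\<omega>. confusions d (unit_cube n) \<omega> \<partial>M)
    = ennreal (\<Lambda> * (1 - exp (- (\<Lambda> * (unit_ball_vol n * vec_norm n d ^ n)))))"
proof (rule antisym)
  have lim1: "(\<lambda>m. (1 / real m) ^ n) \<longlonglongrightarrow> 0"
    using tendsto_power[OF lim_1_over_n[where 'a = real], of n] n_pos by (simp add: power_0_left)
  have lim2: "(\<lambda>m. sqrt n / real m) \<longlonglongrightarrow> 0"
    using tendsto_mult_right_zero[OF lim_1_over_n[where 'a = real], of "sqrt n"] by simp
  have "(\<lambda>m. ennreal (\<Lambda> * (1 - exp (- (\<Lambda> * (unit_ball_vol n * (vec_norm n d + sqrt n / real m) ^ n))))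
        + \<Lambda>\<^sup>2 * (1 / real m) ^ n)) \<longlonglongrightarrow>
     ennreal (\<Lambda> * (1 - exp (- (\<Lambda> * (unit_ball_vol n * (vec_norm n d + 0) ^ n)))) + \<Lambda>\<^sup>2 * 0)"
    by (intro tendsto_intros lim1 lim2)
  then have "(\<integral>\<^sup>+\<omega>. confusions d (unit_cube n) \<omega> \<partial>M) \<le>
     ennreal (\<Lambda> * (1 - exp (- (\<Lambda> * (unit_ball_vol n * (vec_norm n d + 0) ^ n)))) + \<Lambda>\<^sup>2 * 0)"
    by (rule tendsto_lowerbound)
       (auto intro!: eventually_mono[OF eventually_gt_at_top[of 0]] nn_integral_confusions_le d)
  then show "(\<integral>\<^sup>+\<omega>. confusions d (unit_cube n) \<omega> \<partial>M)
    \<le> ennreal (\<Lambda> * (1 - exp (- (\<Lambda> * (unit_ball_vol n * vec_norm n d ^ n)))))"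
    by simp
  show "ennreal (\<Lambda> * (1 - exp (- (\<Lambda> * (unit_ball_vol n * vec_norm n d ^ n)))))
    \<le> (\<integral>\<^sup>+\<omega>. confusions d (unit_cube n) \<omega> \<partial>M)"
  \<comment> \<open>At norm 0 the value to be bounded is 0, as \<open>n \<ge> 1\<close>. Otherwise
    the side conditions of \<open>nn_integral_confusions_ge\<close> hold for all large
    \<open>m\<close>.\<close>
  proof (cases "vec_norm n d = 0")
    case False
    then have pos: "vec_norm n d > 0"
      using vec_norm_nonneg[of n d] by linarith
    have lim: "(\<lambda>m. unit_ball_vol n * (vec_norm n d - sqrt n / real m) ^ n - (1 / real m) ^ n)
        \<longlonglongrightarrow> unit_ball_vol n * (vec_norm n d - 0) ^ n - 0"
      by (intro tendsto_intros lim1 lim2)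
    have e1: "\<forall>\<^sub>F m in sequentially. 0 < unit_ball_vol n * (vec_norm n d - sqrt n / real m) ^ n - (1 / real m) ^ n"
      using order_tendstoD(1)[OF lim, of 0] pos by simp
    have e2: "\<forall>\<^sub>F m in sequentially. sqrt n / real m < vec_norm n d"
      using order_tendstoD(2)[OF lim2 pos] .
    have "(\<lambda>m. ennreal ((\<Lambda> - \<Lambda>\<^sup>2 * (1 / real m) ^ n)
      * (1 - exp (- (\<Lambda> * (unit_ball_vol n * (vec_norm n d - sqrt n / real m) ^ n - (1 / real m) ^ n))))))
      \<longlonglongrightarrow> ennreal ((\<Lambda> - \<Lambda>\<^sup>2 * 0) * (1 - exp (- (\<Lambda> * (unit_ball_vol n * (vec_norm n d - 0) ^ n - 0)))))"
      by (intro tendsto_intros lim1 lim)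
    then have "ennreal ((\<Lambda> - \<Lambda>\<^sup>2 * 0) * (1 - exp (- (\<Lambda> * (unit_ball_vol n * (vec_norm n d - 0) ^ n - 0)))))
      \<le> (\<integral>\<^sup>+\<omega>. confusions d (unit_cube n) \<omega> \<partial>M)"
    proof (rule tendsto_upperbound)
      show "\<forall>\<^sub>F m in sequentially. ennreal ((\<Lambda> - \<Lambda>\<^sup>2 * (1 / real m) ^ n)
        * (1 - exp (- (\<Lambda> * (unit_ball_vol n * (vec_norm n d - sqrt n / real m) ^ n - (1 / real m) ^ n)))))
        \<le> (\<integral>\<^sup>+\<omega>. confusions d (unit_cube n) \<omega> \<partial>M)"
        using e1 e2 eventually_gt_at_top[of 0]
        by eventually_elim (rule nn_integral_confusions_ge, use d in auto)
    qed simp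
    then show ?thesis by simp
  qed (use n_pos in \<open>simp add: power_0_left\<close>)
qed

end

section \<open>The error probability as an average over the displacement\<close>

text \<open>The error event as an existence statement over indices, that is, as a countable union,
  which makes its measurability visible.\<close>

definition confused_event :: "nat \<Rightarrow> (nat \<Rightarrow> vec \<times> vec) set" where
  "confused_event n = {s \<in> space (configurations n). \<exists>j. fst (s j) \<noteq> fst (s 0) \<and>
     vec_dist n (snd (s 0)) (fst (s j)) \<le> vec_dist n (snd (s 0)) (fst (s 0))}"

lemma error_event_eq:
  "{s \<in> space (configurations n). snd (s 0) \<notin> voronoi_cell n (range (\<lambda>k. fst (s k))) (fst (s 0))}
    = confused_event n"
proof -
  have "snd (s 0) \<in> space (lebesgue_n n)" if "s \<in> space (configurations n)" for s
    using that unfolding configurations_def space_PiM space_pair_measure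
    by (auto simp: PiE_iff mem_Times_iff)
  then show ?thesis
    by (auto simp: confused_event_def voronoi_cell_def not_less)
qed

lemma sets_confused_event [measurable]: "confused_event n \<in> sets (configurations n)"
proof -
  have [measurable]: "(\<lambda>s. fst (s j)) \<in> measurable (configurations n) (lebesgue_n n)"
    "(\<lambda>s. snd (s j)) \<in> measurable (configurations n) (lebesgue_n n)" for j
    unfolding configurations_def by measurable
  have [measurable]: "Measurable.pred (configurations n) (\<lambda>s. fst (s j) = fst (s 0))" for j
    by (rule pred_vec_eq) measurable
  have dist: "(\<lambda>s. vec_dist n (snd (s 0)) (fst (s j))) \<in> borel_measurable (configurations n)" for j
    by (rule measurable_vec_dist) measurable
  have [measurable]: "Measurable.pred (configurations n)
      (\<lambda>s. vec_dist n (snd (s 0)) (fst (s j)) \<le> vec_dist n (snd (s 0)) (fst (s 0)))" for j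
    unfolding pred_def by (rule borel_measurable_le[OF dist dist])
  show ?thesis unfolding confused_event_def by measurable
qed

text \<open>Index 0 of the recentred sequence is the old index \<open>k\<close>, and exchanging
  indices is an involution, so that a quantifier over all indices does not notice it.\<close>

lemma recentre_in_confused_event:
  assumes "recentre n k s \<in> space (configurations n)"
  shows "recentre n k s \<in> confused_event n \<longleftrightarrow>
    (\<exists>j. vec_diff n (fst (s j)) (fst (s k)) \<noteq> vec_diff n (fst (s k)) (fst (s k)) \<and>
      vec_dist n (snd (s k)) (vec_diff n (fst (s j)) (fst (s k))) \<le>
      vec_dist n (snd (s k)) (vec_diff n (fst (s k)) (fst (s k))))"
    (is "_ \<longleftrightarrow> (\<exists>j. ?P j)")
proof -
  have "recentre n k s \<in> confused_event n \<longleftrightarrow> (\<exists>j. ?P (Transposition.transpose 0 k j))"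
    using assms by (simp add: confused_event_def recentre_def split_beta)
  also have "\<dots> \<longleftrightarrow> (\<exists>j. ?P j)"
    by (metis transpose_involutory)
  finally show ?thesis .
qed

lemma vec_diff_eq_self_iff:
  assumes "x \<in> space (lebesgue_n n)" "y \<in> space (lebesgue_n n)"
  shows "vec_diff n x y = vec_diff n y y \<longleftrightarrow> x = y"
proof
  assume *: "vec_diff n x y = vec_diff n y y"
  show "x = y"
  proof (rule extensionalityI[of _ "{..<n}"])
    show "x i = y i" if "i \<in> {..<n}" for i
      using fun_cong[OF *, of i] that by (simp add: vec_diff_def)
  qed (use assms in \<open>auto simp: space_lebesgue_n\<close>)
qed simp

context poisson_points
begin

lemma intensity_eq: "intensity M n T = ennreal \<Lambda>"
proof -
  have "(\<integral>\<^sup>+\<omega>. num (unit_cube n) \<omega> \<partial>M) = ennreal (\<Lambda> * 1)"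
    by (rule nn_integral_num_id) (auto simp: unit_cube_eq_cell emeasure_cell)
  then show ?thesis by (simp add: intensity_def num_def)
qed

lemma measurable_recentre:
  assumes [measurable]: "\<And>k. D k \<in> measurable M (lebesgue_n n)"
  shows "(\<lambda>(\<omega>, k). recentre n k (\<lambda>j. (T j \<omega>, D j \<omega>)))
    \<in> measurable (M \<Otimes>\<^sub>M count_space UNIV) (configurations n)"
proof -
  have *: "(\<lambda>\<omega>. recentre n k (\<lambda>j. (T j \<omega>, D j \<omega>))) \<in> measurable M (configurations n)" for k
    unfolding configurations_def recentre_def
  proof (rule measurable_PiM_single')
    fix j
    show "(\<lambda>\<omega>. let (t, d) = (T (Transposition.transpose 0 k j) \<omega>, D (Transposition.transpose 0 k j) \<omega>)
         in (vec_diff n t (fst (T k \<omega>, D k \<omega>)), d)) \<in> M \<rightarrow>\<^sub>M lebesgue_n n \<Otimes>\<^sub>M lebesgue_n n"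
      by simp
    then show "(\<lambda>\<omega>. \<lambda>j. let (t, d) = (T (Transposition.transpose 0 k j) \<omega>, D (Transposition.transpose 0 k j) \<omega>)
         in (vec_diff n t (fst (T k \<omega>, D k \<omega>)), d)) \<in> space M \<rightarrow> (\<Pi>\<^sub>E j\<in>UNIV. space (lebesgue_n n \<Otimes>\<^sub>M lebesgue_n n))"
      using measurable_space[OF T_measurable] measurable_space[OF assms]
        measurable_space[OF measurable_vec_diff[OF T_measurable T_measurable]]
      by (auto simp: space_pair_measure)
  qed
  have "(\<lambda>p. (\<lambda>k p. recentre n k (\<lambda>j. (T j (fst p), D j (fst p)))) (snd p) p)
    \<in> measurable (M \<Otimes>\<^sub>M count_space UNIV) (configurations n)"
    by (rule measurable_compose_countable'[where I = UNIV])
       (auto intro: measurable_compose[OF measurable_fst *])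
  then show ?thesis by (simp add: split_beta')
qed

text \<open>Undoes the recentring: the Palm probability becomes a sum over the original enumeration,
  in which each index still carries its own random displacement.\<close>

lemma emeasure_palm_confused:
  assumes [measurable]: "\<And>k. D k \<in> measurable M (lebesgue_n n)"
  shows "emeasure (palm M n T D) (confused_event n) = inverse (ennreal \<Lambda>) *
    (\<Sum>k. \<integral>\<^sup>+\<omega>. indicator (unit_cube n) (T k \<omega>) * (if confusable n (\<lambda>j. T j \<omega>) (D k \<omega>) k then 1 else 0) \<partial>M)"
proof -
  define f where "f = (\<lambda>(\<omega>, k). recentre n k (\<lambda>j. (T j \<omega>, D j \<omega>)))"
  define g where "g = (\<lambda>(\<omega>, k). indicator (unit_cube n) (T k \<omega>) :: ennreal)"
  define h :: "'a \<Rightarrow> nat \<Rightarrow> ennreal" where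
    "h \<omega> k = indicator (unit_cube n) (T k \<omega>) * (if confusable n (\<lambda>j. T j \<omega>) (D k \<omega>) k then 1 else 0)" for \<omega> k
  note f [measurable] = measurable_recentre[of D, OF assms, folded f_def]
  have g [measurable]: "g \<in> borel_measurable (M \<Otimes>\<^sub>M count_space UNIV)"
  proof -
    have "(\<lambda>p. (\<lambda>k p. indicator (unit_cube n) (T k (fst p)) :: ennreal) (snd p) p)
        \<in> borel_measurable (M \<Otimes>\<^sub>M count_space UNIV)"
      by (rule measurable_compose_countable'[where I = UNIV]) auto
    then show ?thesis by (simp add: g_def split_beta')
  qed
  have gh: "g (\<omega>, k) * indicator (confused_event n) (f (\<omega>, k)) = h \<omega> k" if "\<omega> \<in> space M" for \<omega> k
  proof -
    have "(\<omega>, k) \<in> space (M \<Otimes>\<^sub>M count_space UNIV)"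
      using that by (simp add: space_pair_measure)
    from measurable_space[OF f this] have "f (\<omega>, k) \<in> space (configurations n)" .
    then have "f (\<omega>, k) \<in> confused_event n \<longleftrightarrow> confusable n (\<lambda>j. T j \<omega>) (D k \<omega>) k"
      using T_space[OF that] unfolding f_def
      by (simp add: recentre_in_confused_event confusable_def vec_diff_eq_self_iff)
    then show ?thesis
      by (simp add: g_def h_def indicator_def)
  qed
  have [measurable]: "(\<lambda>\<omega>. h \<omega> k) \<in> borel_measurable M" for k
  proof -
    have [measurable]: "Measurable.pred M (\<lambda>\<omega>. confusable n (\<lambda>j. T j \<omega>) (D k \<omega>) k)"
      by (rule pred_confusable) auto
    show ?thesis unfolding h_def by measurable
  qed
  interpret count: sigma_finite_measure "count_space (UNIV :: nat set)"
    by (rule sigma_finite_measure_count_space)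
  have "emeasure (palm M n T D) (confused_event n)
      = inverse (ennreal \<Lambda>) * emeasure (distr (density (M \<Otimes>\<^sub>M count_space UNIV) g) (configurations n) f) (confused_event n)"
    by (simp add: palm_def intensity_eq f_def g_def)
  also have "emeasure (distr (density (M \<Otimes>\<^sub>M count_space UNIV) g) (configurations n) f) (confused_event n)
      = emeasure (density (M \<Otimes>\<^sub>M count_space UNIV) g) (f -` confused_event n \<inter> space (M \<Otimes>\<^sub>M count_space UNIV))"
    by (subst emeasure_distr) auto
  also have "\<dots> = (\<integral>\<^sup>+p. g p * indicator (f -` confused_event n \<inter> space (M \<Otimes>\<^sub>M count_space UNIV)) p \<partial>(M \<Otimes>\<^sub>M count_space UNIV))"
    by (intro emeasure_density) measurable
  also have "\<dots> = (\<integral>\<^sup>+p. g p * indicator (confused_event n) (f p) \<partial>(M \<Otimes>\<^sub>M count_space UNIV))"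
    by (intro nn_integral_cong) (auto simp: indicator_def)
  also have "\<dots> = (\<integral>\<^sup>+\<omega>. \<integral>\<^sup>+k. g (\<omega>, k) * indicator (confused_event n) (f (\<omega>, k)) \<partial>count_space UNIV \<partial>M)"
    by (intro count.nn_integral_fst[symmetric]) measurable
  also have "\<dots> = (\<integral>\<^sup>+\<omega>. (\<Sum>k. h \<omega> k) \<partial>M)"
    by (intro nn_integral_cong) (simp add: nn_integral_count_space_nat gh)
  also have "\<dots> = (\<Sum>k. \<integral>\<^sup>+\<omega>. h \<omega> k \<partial>M)"
    by (intro nn_integral_suminf) measurable
  finally show ?thesis by (simp add: h_def)
qed

lemma measurable_conditional_error:
  "(\<lambda>d. ennreal (1 - exp (- (\<Lambda> * (unit_ball_vol n * vec_norm n d ^ n))))) \<in> borel_measurable (lebesgue_n n)"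
  by measurable

text \<open>After freezing, all summands are integrated against the same law \<open>\<nu>\<close>,
  so the sum over \<open>k\<close> can move inside. There it counts confusable points for a fixed
  \<open>d\<close>, and the enumeration disappears; the factor \<open>\<Lambda>\<close> cancels
  against the intensity.\<close>

lemma error_probability_eq:
  assumes D [measurable]: "\<And>k. D k \<in> measurable M (lebesgue_n n)"
    and iid: "iid_displacements M n T D \<nu>"
  shows "ennreal (error_probability M n T D)
    = (\<integral>\<^sup>+d. ennreal (1 - exp (- (\<Lambda> * (unit_ball_vol n * vec_norm n d ^ n)))) \<partial>\<nu>)"
proof -
  define S where "S = (\<Pi>\<^sub>M k\<in>(UNIV :: nat set). lebesgue_n n)"
  define h :: "nat \<Rightarrow> (nat \<Rightarrow> vec) \<Rightarrow> vec \<Rightarrow> ennreal" where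
    "h k t d = indicator (unit_cube n) (t k) * (if confusable n t d k then 1 else 0)" for k t d
  have \<nu>: "\<nu> = distr M (lebesgue_n n) (D k)" for k
    using iid by (simp add: iid_displacements_def)
  have sets_\<nu> [measurable_cong]: "sets \<nu> = sets (lebesgue_n n)"
    unfolding \<nu>[of 0] by simp
  interpret \<nu>: prob_space \<nu>
    unfolding \<nu>[of 0] by (rule prob_space_distr) simp
  have [measurable]: "(\<lambda>\<omega> k. T k \<omega>) \<in> measurable M S"
    using measurable_space[OF T_measurable] unfolding S_def
    by (intro measurable_PiM_single') auto
  have [measurable]: "(\<lambda>\<omega> k. D k \<omega>) \<in> measurable M S"
    using measurable_space[OF D] unfolding S_def
    by (intro measurable_PiM_single') auto
  have [measurable]: "(\<lambda>t. t j) \<in> measurable S (lebesgue_n n)" for j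
    unfolding S_def by measurable
  have h [measurable]: "(\<lambda>(t, d). h k t d) \<in> borel_measurable (S \<Otimes>\<^sub>M lebesgue_n n)" for k
  proof -
    have [measurable]: "Measurable.pred (S \<Otimes>\<^sub>M lebesgue_n n) (\<lambda>x. confusable n (fst x) (snd x) k)"
      by (rule pred_confusable) auto
    show ?thesis unfolding h_def split_beta' by measurable
  qed
  define \<tau> where "\<tau> = distr M S (\<lambda>\<omega> k. T k \<omega>)"
  have sets_\<tau> [measurable_cong]: "sets \<tau> = sets S"
    by (simp add: \<tau>_def)
  interpret \<tau>: prob_space \<tau>
    unfolding \<tau>_def by (rule prob_space_distr) measurable
  define \<delta> where "\<delta> = distr M S (\<lambda>\<omega> k. D k \<omega>)"
  have sets_\<delta> [measurable_cong]: "sets \<delta> = sets S"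
    by (simp add: \<delta>_def)
  interpret \<delta>: prob_space \<delta>
    unfolding \<delta>_def by (rule prob_space_distr) measurable
  interpret \<tau>\<delta>: pair_sigma_finite \<tau> \<delta>
    by standard
  \<comment> \<open>The joint law of points and displacements is a product, and the integrand sees
    only the \<open>k\<close>-th displacement, whose law is \<open>\<nu>\<close>. Points and
    displacement can thus be integrated separately.\<close>
  have one: "(\<integral>\<^sup>+\<omega>. h k (\<lambda>j. T j \<omega>) (D k \<omega>) \<partial>M) = (\<integral>\<^sup>+d. \<integral>\<^sup>+\<omega>. h k (\<lambda>j. T j \<omega>) d \<partial>M \<partial>\<nu>)" for k
  proof -
    have "indep_var S (\<lambda>\<omega> k. T k \<omega>) S (\<lambda>\<omega> k. D k \<omega>)"
      using iid by (simp add: iid_displacements_def S_def)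
    then have joint: "distr M (S \<Otimes>\<^sub>M S) (\<lambda>\<omega>. (\<lambda>k. T k \<omega>, \<lambda>k. D k \<omega>)) = \<tau> \<Otimes>\<^sub>M \<delta>"
      unfolding indep_var_distribution_eq by (simp add: \<tau>_def \<delta>_def)
    have "(\<integral>\<^sup>+\<omega>. h k (\<lambda>j. T j \<omega>) (D k \<omega>) \<partial>M)
        = (\<integral>\<^sup>+x. (case x of (t, s) \<Rightarrow> h k t (s k)) \<partial>(\<tau> \<Otimes>\<^sub>M \<delta>))"
      unfolding joint[symmetric] by (subst nn_integral_distr) auto
    also have "\<dots> = (\<integral>\<^sup>+s. \<integral>\<^sup>+t. h k t (s k) \<partial>\<tau> \<partial>\<delta>)"
      by (subst \<tau>\<delta>.nn_integral_snd[symmetric]) auto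
    also have "\<dots> = (\<integral>\<^sup>+\<omega>. \<integral>\<^sup>+t. h k t (D k \<omega>) \<partial>\<tau> \<partial>M)"
      unfolding \<delta>_def by (subst nn_integral_distr) auto
    also have "\<dots> = (\<integral>\<^sup>+d. \<integral>\<^sup>+t. h k t d \<partial>\<tau> \<partial>\<nu>)"
      unfolding \<nu>[of k] by (subst nn_integral_distr) auto
    also have "\<dots> = (\<integral>\<^sup>+d. \<integral>\<^sup>+\<omega>. h k (\<lambda>j. T j \<omega>) d \<partial>M \<partial>\<nu>)"
      unfolding \<tau>_def
      by (intro nn_integral_cong nn_integral_distr) (auto simp: \<nu>[of 0])
    finally show ?thesis .
  qed
  have hM [measurable]: "(\<lambda>(d, \<omega>). h k (\<lambda>j. T j \<omega>) d) \<in> borel_measurable (\<nu> \<Otimes>\<^sub>M M)" for k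
    by measurable
  have "(\<Sum>k. \<integral>\<^sup>+\<omega>. h k (\<lambda>j. T j \<omega>) (D k \<omega>) \<partial>M) = (\<integral>\<^sup>+d. (\<Sum>k. \<integral>\<^sup>+\<omega>. h k (\<lambda>j. T j \<omega>) d \<partial>M) \<partial>\<nu>)"
    unfolding one by (intro nn_integral_suminf[symmetric]) measurable
  also have "\<dots> = (\<integral>\<^sup>+d. ennreal \<Lambda> * ennreal (1 - exp (- (\<Lambda> * (unit_ball_vol n * vec_norm n d ^ n)))) \<partial>\<nu>)"
  proof (rule nn_integral_cong)
    fix d assume "d \<in> space \<nu>"
    then have d [measurable]: "d \<in> space (lebesgue_n n)"
      using sets_eq_imp_space_eq[OF sets_\<nu>] by simp
    have [measurable]: "(\<lambda>\<omega>. h k (\<lambda>j. T j \<omega>) d) \<in> borel_measurable M" for k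
      by measurable
    have "confusions d (unit_cube n) \<omega> = (\<Sum>k. h k (\<lambda>j. T j \<omega>) d)" for \<omega>
      by (simp add: confusions_def h_def)
    then have "(\<Sum>k. \<integral>\<^sup>+\<omega>. h k (\<lambda>j. T j \<omega>) d \<partial>M) = (\<integral>\<^sup>+\<omega>. confusions d (unit_cube n) \<omega> \<partial>M)"
      by (simp add: nn_integral_suminf)
    then show "(\<Sum>k. \<integral>\<^sup>+\<omega>. h k (\<lambda>j. T j \<omega>) d \<partial>M)
        = ennreal \<Lambda> * ennreal (1 - exp (- (\<Lambda> * (unit_ball_vol n * vec_norm n d ^ n))))"
      using \<Lambda>_pos by (simp add: nn_integral_confusions[OF d] ennreal_mult')
  qed
  also have "\<dots> = ennreal \<Lambda> * (\<integral>\<^sup>+d. ennreal (1 - exp (- (\<Lambda> * (unit_ball_vol n * vec_norm n d ^ n)))) \<partial>\<nu>)"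
    using measurable_conditional_error
    by (intro nn_integral_cmult) (simp cong: measurable_cong_sets add: sets_\<nu>)
  finally have "emeasure (palm M n T D) (confused_event n) = inverse (ennreal \<Lambda>) *
      (ennreal \<Lambda> * (\<integral>\<^sup>+d. ennreal (1 - exp (- (\<Lambda> * (unit_ball_vol n * vec_norm n d ^ n)))) \<partial>\<nu>))"
    using emeasure_palm_confused[of D, OF D] by (simp add: h_def)
  also have "\<dots> = (\<integral>\<^sup>+d. ennreal (1 - exp (- (\<Lambda> * (unit_ball_vol n * vec_norm n d ^ n)))) \<partial>\<nu>)"
    using \<Lambda>_pos by (simp add: mult.assoc[symmetric] inverse_ennreal flip: ennreal_mult)
  finally have eq: "emeasure (palm M n T D) (confused_event n)
      = (\<integral>\<^sup>+d. ennreal (1 - exp (- (\<Lambda> * (unit_ball_vol n * vec_norm n d ^ n)))) \<partial>\<nu>)" .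
  \<comment> \<open>\<open>error_probability\<close> is a real-valued \<open>measure\<close>, which
    would be 0 on a set of infinite measure, so finiteness has to be shown.\<close>
  also have "\<dots> \<le> (\<integral>\<^sup>+d. 1 \<partial>\<nu>)"
    by (intro nn_integral_mono) (auto simp flip: ennreal_1 intro!: ennreal_leI)
  also have "\<dots> < \<infinity>" by (simp add: \<nu>.emeasure_space_1)
  finally have "emeasure (palm M n T D) (confused_event n) = ennreal (error_probability M n T D)"
    unfolding error_probability_def error_event_eq by (intro emeasure_eq_ennreal_measure) auto
  with eq show ?thesis by simp
qed

end

section \<open>White Gaussian vectors\<close>

lemma vec_norm_square: "(vec_norm n x)\<^sup>2 = (\<Sum>i<n. (x i)\<^sup>2)"
  by (simp add: vec_norm_def sum_nonneg)

text \<open>The normalising factor is kept in the exponent, because all later comparisons are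
  between exponents linear in \<open>n\<close>.\<close>

definition gauss_density :: "nat \<Rightarrow> real \<Rightarrow> vec \<Rightarrow> real" where
  "gauss_density n \<sigma> x = exp (- (n / 2) * ln (2 * pi * \<sigma>\<^sup>2) - (vec_norm n x)\<^sup>2 / (2 * \<sigma>\<^sup>2))"

lemma measurable_gauss_density [measurable]: "gauss_density n \<sigma> \<in> borel_measurable (lebesgue_n n)"
  unfolding gauss_density_def[abs_def] by measurable

lemma prod_normal_density:
  assumes "\<sigma> > 0"
  shows "(\<Prod>i<n. normal_density 0 \<sigma> (x i)) = gauss_density n \<sigma> x"
proof -
  have "normal_density 0 \<sigma> y = exp (- (1 / 2) * ln (2 * pi * \<sigma>\<^sup>2) - y\<^sup>2 / (2 * \<sigma>\<^sup>2))" for y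
  proof -
    have "2 * pi * \<sigma>\<^sup>2 > 0" using assms by simp
    then have "exp ((1 / 2) * ln (2 * pi * \<sigma>\<^sup>2)) = exp (ln (sqrt (2 * pi * \<sigma>\<^sup>2)))"
      by (subst ln_sqrt) auto
    also have "\<dots> = sqrt (2 * pi * \<sigma>\<^sup>2)"
      using assms by (intro exp_ln) simp
    finally have "exp ((1 / 2) * ln (2 * pi * \<sigma>\<^sup>2)) = sqrt (2 * pi * \<sigma>\<^sup>2)" .
    moreover have "exp (- (1 / 2) * ln (2 * pi * \<sigma>\<^sup>2) - y\<^sup>2 / (2 * \<sigma>\<^sup>2))
        = exp (- y\<^sup>2 / (2 * \<sigma>\<^sup>2)) / exp ((1 / 2) * ln (2 * pi * \<sigma>\<^sup>2))"
      by (subst exp_diff[symmetric]) (simp add: algebra_simps)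
    ultimately show ?thesis
      by (simp add: normal_density_def)
  qed
  then have "(\<Prod>i<n. normal_density 0 \<sigma> (x i))
      = exp (\<Sum>i<n. - (1 / 2) * ln (2 * pi * \<sigma>\<^sup>2) - (x i)\<^sup>2 / (2 * \<sigma>\<^sup>2))"
    by (simp add: exp_sum)
  also have "\<dots> = gauss_density n \<sigma> x"
    by (simp add: gauss_density_def vec_norm_square sum_subtractf sum_divide_distrib)
  finally show ?thesis .
qed

lemma sets_white_gaussian [measurable_cong]: "sets (white_gaussian n \<sigma>) = sets (lebesgue_n n)"
  unfolding white_gaussian_def lebesgue_n_def by (intro sets_PiM_cong) auto

lemma space_white_gaussian: "space (white_gaussian n \<sigma>) = space (lebesgue_n n)"
  by (rule sets_eq_imp_space_eq[OF sets_white_gaussian])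

lemma prob_space_white_gaussian:
  assumes "\<sigma> > 0" shows "prob_space (white_gaussian n \<sigma>)"
  unfolding white_gaussian_def using assms by (intro prob_space_PiM prob_space_normal_density)

lemma white_gaussian_eq_density:
  assumes "\<sigma> > 0"
  shows "white_gaussian n \<sigma> = density (lebesgue_n n) (\<lambda>x. ennreal (gauss_density n \<sigma> x))"
proof -
  let ?N = "density lborel (\<lambda>x. ennreal (normal_density 0 \<sigma> x)) :: real measure"
  interpret prob_space ?N
    using assms by (rule prob_space_normal_density)
  interpret N: product_sigma_finite "\<lambda>_::nat. ?N"
    by standard
  have "density (lebesgue_n n) (\<lambda>x. ennreal (gauss_density n \<sigma> x)) = Pi\<^sub>M {..<n} (\<lambda>_. ?N)"
  proof (rule N.PiM_eqI)
    fix A :: "nat \<Rightarrow> real set"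
    assume "\<And>i. i \<in> {..<n} \<Longrightarrow> A i \<in> sets ?N"
    then have A [measurable]: "A i \<in> sets borel" if "i < n" for i
      using that by simp
    have [measurable]: "Pi\<^sub>E {..<n} A \<in> sets (lebesgue_n n)"
      unfolding lebesgue_n_def using A by (intro sets_PiM_I_finite) auto
    have "emeasure (density (lebesgue_n n) (\<lambda>x. ennreal (gauss_density n \<sigma> x))) (Pi\<^sub>E {..<n} A)
        = (\<integral>\<^sup>+x. ennreal (gauss_density n \<sigma> x) * indicator (Pi\<^sub>E {..<n} A) x \<partial>lebesgue_n n)"
      by (intro emeasure_density) measurable
    also have "\<dots> = (\<integral>\<^sup>+x. (\<Prod>i<n. ennreal (normal_density 0 \<sigma> (x i)) * indicator (A i) (x i)) \<partial>lebesgue_n n)"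
    proof (rule nn_integral_cong)
      fix x assume "x \<in> space (lebesgue_n n)"
      then have "(indicator (Pi\<^sub>E {..<n} A) x :: ennreal) = (\<Prod>i<n. indicator (A i) (x i))"
        by (auto simp: indicator_def space_lebesgue_n PiE_iff prod_zero_iff)
      then show "ennreal (gauss_density n \<sigma> x) * indicator (Pi\<^sub>E {..<n} A) x
          = (\<Prod>i<n. ennreal (normal_density 0 \<sigma> (x i)) * indicator (A i) (x i))"
        using prod_normal_density[OF assms, of x n, symmetric]
        by (simp add: prod.distrib prod_ennreal)
    qed
    also have "\<dots> = (\<Prod>i<n. \<integral>\<^sup>+y. ennreal (normal_density 0 \<sigma> y) * indicator (A i) y \<partial>lborel)"
      unfolding lebesgue_n_def by (intro lborel_product.product_nn_integral_prod) auto
    also have "\<dots> = (\<Prod>i<n. emeasure ?N (A i))"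
      by (intro prod.cong) (auto simp: emeasure_density)
    finally show "emeasure (density (lebesgue_n n) (\<lambda>x. ennreal (gauss_density n \<sigma> x))) (Pi\<^sub>E {..<n} A)
      = (\<Prod>i\<in>{..<n}. emeasure ?N (A i))" .
  next
    show "sets (density (lebesgue_n n) (\<lambda>x. ennreal (gauss_density n \<sigma> x))) = sets (Pi\<^sub>M {..<n} (\<lambda>_. ?N))"
      unfolding lebesgue_n_def by simp (intro sets_PiM_cong, auto)
  qed simp
  then show ?thesis by (simp add: white_gaussian_def)
qed

lemma emeasure_white_gaussian:
  assumes "\<sigma> > 0" "A \<in> sets (lebesgue_n n)"
  shows "emeasure (white_gaussian n \<sigma>) A = (\<integral>\<^sup>+x. ennreal (gauss_density n \<sigma> x) * indicator A x \<partial>lebesgue_n n)"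
  using assms by (simp add: white_gaussian_eq_density emeasure_density)

text \<open>Exponential tilting: the weighted density is \<open>(1 - u) powr (- n / 2)\<close> times
  the Gaussian density of variance \<open>\<tau>\<^sup>2\<close>, whose total mass is 1. Negative
  \<open>u\<close> is included and serves for lower tails.\<close>

lemma gaussian_exp_moment:
  assumes "\<sigma> > 0" "u < 1"
  shows "(\<integral>\<^sup>+x. ennreal (exp (u * (vec_norm n x)\<^sup>2 / (2 * \<sigma>\<^sup>2))) \<partial>white_gaussian n \<sigma>)
    = ennreal (exp (- (n / 2) * ln (1 - u)))"
proof -
  define \<tau> where "\<tau> = \<sigma> / sqrt (1 - u)"
  have \<tau>: "\<tau> > 0" "\<tau>\<^sup>2 = \<sigma>\<^sup>2 / (1 - u)"
    using assms by (auto simp: \<tau>_def power_divide)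
  interpret prob_space "white_gaussian n \<tau>"
    using \<tau>(1) by (rule prob_space_white_gaussian)
  have "gauss_density n \<sigma> x * exp (u * (vec_norm n x)\<^sup>2 / (2 * \<sigma>\<^sup>2))
      = exp (- (n / 2) * ln (1 - u)) * gauss_density n \<tau> x" for x
  proof -
    have eq1: "ln (2 * pi * \<tau>\<^sup>2) = ln (2 * pi * \<sigma>\<^sup>2) - ln (1 - u)"
      using assms by (simp add: \<tau>(2) ln_div ln_mult)
    have eq2: "(vec_norm n x)\<^sup>2 / (2 * \<tau>\<^sup>2) = (vec_norm n x)\<^sup>2 / (2 * \<sigma>\<^sup>2) - u * (vec_norm n x)\<^sup>2 / (2 * \<sigma>\<^sup>2)"
      using assms by (simp add: \<tau>(2) field_simps)
    show ?thesis
      unfolding gauss_density_def exp_add[symmetric] eq1 eq2 by (simp add: algebra_simps)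
  qed
  then have "(\<integral>\<^sup>+x. ennreal (exp (u * (vec_norm n x)\<^sup>2 / (2 * \<sigma>\<^sup>2))) \<partial>white_gaussian n \<sigma>)
      = (\<integral>\<^sup>+x. ennreal (exp (- (n / 2) * ln (1 - u))) * ennreal (gauss_density n \<tau> x) \<partial>lebesgue_n n)"
    using assms by (simp add: white_gaussian_eq_density nn_integral_density gauss_density_def flip: ennreal_mult)
  also have "\<dots> = ennreal (exp (- (n / 2) * ln (1 - u))) * (\<integral>\<^sup>+x. ennreal (gauss_density n \<tau> x) \<partial>lebesgue_n n)"
    by (intro nn_integral_cmult) measurable
  also have "(\<integral>\<^sup>+x. ennreal (gauss_density n \<tau> x) \<partial>lebesgue_n n) = emeasure (white_gaussian n \<tau>) (space (lebesgue_n n))"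
    by (subst emeasure_white_gaussian[OF \<tau>(1)]) (auto intro!: nn_integral_cong)
  also have "\<dots> = 1"
    using emeasure_space_1 by (simp add: space_white_gaussian)
  finally show ?thesis by simp
qed

text \<open>Markov's inequality for the exponential moment; positive \<open>u\<close> handles large
  norms and negative \<open>u\<close> small ones.\<close>

lemma gaussian_chernoff:
  assumes "\<sigma> > 0" "u < 1" "A \<in> sets (lebesgue_n n)"
    and "\<And>x. x \<in> A \<Longrightarrow> c \<le> u * (vec_norm n x)\<^sup>2 / (2 * \<sigma>\<^sup>2)"
  shows "emeasure (white_gaussian n \<sigma>) A \<le> ennreal (exp (- c - (n / 2) * ln (1 - u)))"
proof -
  have le: "indicator A x \<le> ennreal (exp (- c)) * ennreal (exp (u * (vec_norm n x)\<^sup>2 / (2 * \<sigma>\<^sup>2)))" for x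
    using assms(4)[of x] by (cases "x \<in> A") (simp_all flip: ennreal_mult exp_add)
  have "emeasure (white_gaussian n \<sigma>) A = (\<integral>\<^sup>+x. indicator A x \<partial>white_gaussian n \<sigma>)"
    using assms(3) by (simp add: sets_white_gaussian)
  also have "\<dots> \<le> (\<integral>\<^sup>+x. ennreal (exp (- c)) * ennreal (exp (u * (vec_norm n x)\<^sup>2 / (2 * \<sigma>\<^sup>2))) \<partial>white_gaussian n \<sigma>)"
    by (intro nn_integral_mono le)
  also have "\<dots> = ennreal (exp (- c)) * (\<integral>\<^sup>+x. ennreal (exp (u * (vec_norm n x)\<^sup>2 / (2 * \<sigma>\<^sup>2))) \<partial>white_gaussian n \<sigma>)"
    by (intro nn_integral_cmult) measurable
  also have "\<dots> = ennreal (exp (- c - (n / 2) * ln (1 - u)))"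
    unfolding gaussian_exp_moment[OF assms(1,2)] by (simp flip: ennreal_mult exp_add)
  finally show ?thesis .
qed

section \<open>Concentration around the mean \<open>n * \<sigma>\<^sup>2\<close> of the squared
  norm, and ball volumes\<close>

definition shell :: "nat \<Rightarrow> real \<Rightarrow> real \<Rightarrow> vec set" where
  "shell n \<delta> \<sigma> = {x \<in> space (lebesgue_n n).
     (1 - \<delta>) * (n * \<sigma>\<^sup>2) \<le> (vec_norm n x)\<^sup>2 \<and> (vec_norm n x)\<^sup>2 \<le> (1 + \<delta>) * (n * \<sigma>\<^sup>2)}"

lemma sets_shell [measurable]: "shell n \<delta> \<sigma> \<in> sets (lebesgue_n n)"
  unfolding shell_def by measurable

lemma eventually_exp_minus_linear_le:
  assumes "a > 0" "c > (0 :: real)"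
  shows "\<forall>\<^sub>F n in sequentially. exp (- (real n * a)) \<le> c"
proof -
  have "(\<lambda>n. exp (- a) ^ n) \<longlonglongrightarrow> 0"
    using assms(1) by (intro LIMSEQ_power_zero) simp
  then have "\<forall>\<^sub>F n in sequentially. exp (- a) ^ n < c"
    using assms(2) by (rule order_tendstoD)
  then show ?thesis
    by eventually_elim (simp add: exp_of_nat_mult[symmetric])
qed

text \<open>The threshold in \<open>n\<close> has to be the same for all variances: to estimate the
  volume of an error ball, the variance will be chosen according to the displacement. By scaling,
  the Chernoff rates involve \<open>\<delta>\<close> only.\<close>

lemma eventually_shell_half:
  assumes "0 < \<delta>" "\<delta> < 1"
  shows "\<forall>\<^sub>F n in sequentially. \<forall>\<sigma>>0. ennreal (1 / 2) \<le> emeasure (white_gaussian n \<sigma>) (shell n \<delta> \<sigma>)"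
proof -
  \<comment> \<open>\<open>a\<close> and \<open>b\<close> are the rates of the upper and the lower
    tail, positive since ln x < x - 1 for x different from 1. Each tail will get mass at most
    1/4.\<close>
  define a where "a = (\<delta> - ln (1 + \<delta>)) / 2"
  define b where "b = (- ln (1 - \<delta>) - \<delta>) / 2"
  have "a > 0" using assms ln_add_one_self_le_self2[of \<delta>] ln_less_self[of "1 + \<delta>"]
    by (simp add: a_def ln_add_one_self_less_self)
  moreover have "b > 0"
    using assms ln_one_minus_pos_upper_bound[of \<delta>] ln_eq_minus_one[of "1 - \<delta>"]
    by (cases "ln (1 - \<delta>) = - \<delta>") (auto simp: b_def)
  ultimately have "\<forall>\<^sub>F n in sequentially. exp (- (real n * a)) \<le> 1 / 4 \<and> exp (- (real n * b)) \<le> 1 / 4"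
    by (intro eventually_conj eventually_exp_minus_linear_le) auto
  then show ?thesis
  proof (eventually_elim, intro allI impI)
    fix n :: nat and \<sigma> :: real
    assume n: "exp (- (real n * a)) \<le> 1 / 4 \<and> exp (- (real n * b)) \<le> 1 / 4" and \<sigma>: "\<sigma> > 0"
    define A where "A = {x \<in> space (lebesgue_n n). (1 + \<delta>) * (n * \<sigma>\<^sup>2) < (vec_norm n x)\<^sup>2}"
    define B where "B = {x \<in> space (lebesgue_n n). (vec_norm n x)\<^sup>2 < (1 - \<delta>) * (n * \<sigma>\<^sup>2)}"
    have AB [measurable]: "A \<in> sets (lebesgue_n n)" "B \<in> sets (lebesgue_n n)"
      unfolding A_def B_def by measurable
    interpret prob_space "white_gaussian n \<sigma>"
      using \<sigma> by (rule prob_space_white_gaussian)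
    \<comment> \<open>Here u = \<open>\<delta> / (1 + \<delta>)\<close>, which tilts the variance to
      \<open>(1 + \<delta>) * \<sigma>\<^sup>2\<close>, the boundary of the tail. For
      \<open>B\<close> the corresponding choice is
      \<open>- \<delta> / (1 - \<delta>)\<close>.\<close>
    have "emeasure (white_gaussian n \<sigma>) A \<le> ennreal (exp (- (n / 2 * \<delta>) - (n / 2) * ln (1 - \<delta> / (1 + \<delta>))))"
    proof (rule gaussian_chernoff[OF \<sigma> _ AB(1)])
      fix x assume "x \<in> A"
      then have "(1 + \<delta>) * (n * \<sigma>\<^sup>2) \<le> (vec_norm n x)\<^sup>2" by (simp add: A_def)
      then have "\<delta> / (1 + \<delta>) * ((1 + \<delta>) * (n * \<sigma>\<^sup>2)) / (2 * \<sigma>\<^sup>2) \<le> \<delta> / (1 + \<delta>) * (vec_norm n x)\<^sup>2 / (2 * \<sigma>\<^sup>2)"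
        using assms by (intro divide_right_mono mult_left_mono) auto
      also have "\<delta> / (1 + \<delta>) * ((1 + \<delta>) * (n * \<sigma>\<^sup>2)) / (2 * \<sigma>\<^sup>2) = n / 2 * \<delta>"
        using assms \<sigma> by simp
      finally show "n / 2 * \<delta> \<le> \<delta> / (1 + \<delta>) * (vec_norm n x)\<^sup>2 / (2 * \<sigma>\<^sup>2)" .
    qed (use assms in auto)
    also have "ln (1 - \<delta> / (1 + \<delta>)) = - ln (1 + \<delta>)"
      using assms by (simp add: ln_div[symmetric] ln_inverse[symmetric] field_simps)
    also have "exp (- (n / 2 * \<delta>) - (n / 2) * - ln (1 + \<delta>)) = exp (- (real n * a))"
      by (simp add: a_def field_simps)
    finally have A: "prob A \<le> 1 / 4"
      using n by (simp add: emeasure_eq_measure)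
    have "emeasure (white_gaussian n \<sigma>) B \<le> ennreal (exp (- (- (n / 2 * \<delta>)) - (n / 2) * ln (1 - (- \<delta> / (1 - \<delta>)))))"
    proof (rule gaussian_chernoff[OF \<sigma> _ AB(2)])
      fix x assume "x \<in> B"
      then have "(vec_norm n x)\<^sup>2 \<le> (1 - \<delta>) * (n * \<sigma>\<^sup>2)" by (simp add: B_def)
      then have "- \<delta> / (1 - \<delta>) * ((1 - \<delta>) * (n * \<sigma>\<^sup>2)) / (2 * \<sigma>\<^sup>2) \<le> - \<delta> / (1 - \<delta>) * (vec_norm n x)\<^sup>2 / (2 * \<sigma>\<^sup>2)"
        using assms by (intro divide_right_mono mult_left_mono_neg) auto
      also have "- \<delta> / (1 - \<delta>) * ((1 - \<delta>) * (n * \<sigma>\<^sup>2)) / (2 * \<sigma>\<^sup>2) = - (n / 2 * \<delta>)"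
        using assms \<sigma> by simp
      finally show "- (n / 2 * \<delta>) \<le> - \<delta> / (1 - \<delta>) * (vec_norm n x)\<^sup>2 / (2 * \<sigma>\<^sup>2)" .
    qed (use assms in \<open>auto simp: field_simps\<close>)
    also have "ln (1 - (- \<delta> / (1 - \<delta>))) = - ln (1 - \<delta>)"
      using assms by (simp add: ln_inverse[symmetric] field_simps)
    also have "exp (- (- (n / 2 * \<delta>)) - (n / 2) * - ln (1 - \<delta>)) = exp (- (real n * b))"
      by (simp add: b_def field_simps)
    finally have B: "prob B \<le> 1 / 4"
      using n by (simp add: emeasure_eq_measure)
    have "space (lebesgue_n n) = A \<union> B \<union> shell n \<delta> \<sigma>"
      by (auto simp: A_def B_def shell_def)
    then have "1 = prob (A \<union> B \<union> shell n \<delta> \<sigma>)"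
      using prob_space by (simp add: space_white_gaussian)
    also have "\<dots> \<le> prob (A \<union> B) + prob (shell n \<delta> \<sigma>)"
      by (rule measure_Un_le) (auto simp: sets_white_gaussian)
    also have "prob (A \<union> B) \<le> prob A + prob B"
      by (rule measure_Un_le) (auto simp: sets_white_gaussian)
    finally have "1 / 2 \<le> prob (shell n \<delta> \<sigma>)"
      using A B by linarith
    then show "ennreal (1 / 2) \<le> emeasure (white_gaussian n \<sigma>) (shell n \<delta> \<sigma>)"
      unfolding emeasure_eq_measure by (rule ennreal_leI)
  qed
qed

text \<open>On the shell the density is at most \<open>c\<close>, its value on the inner sphere, so
  that mass 1/2 forces a volume of at least 1 / (2 c).\<close>

lemma shell_volume_ge:
  assumes "\<sigma> > 0" "ennreal (1 / 2) \<le> emeasure (white_gaussian n \<sigma>) (shell n \<delta> \<sigma>)"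
  shows "ennreal (exp (n / 2 * (ln (2 * pi * \<sigma>\<^sup>2) + 1 - \<delta>)) / 2) \<le> emeasure (lebesgue_n n) (shell n \<delta> \<sigma>)"
proof -
  define c where "c = exp (- (n / 2) * (ln (2 * pi * \<sigma>\<^sup>2) + 1 - \<delta>))"
  have "c > 0" by (simp add: c_def)
  have "gauss_density n \<sigma> x \<le> c" if "x \<in> shell n \<delta> \<sigma>" for x
  proof -
    have "n / 2 * (1 - \<delta>) = (1 - \<delta>) * (n * \<sigma>\<^sup>2) / (2 * \<sigma>\<^sup>2)"
      using assms(1) by simp
    also have "\<dots> \<le> (vec_norm n x)\<^sup>2 / (2 * \<sigma>\<^sup>2)"
      using that assms(1) by (intro divide_right_mono) (auto simp: shell_def)
    finally show ?thesis
      unfolding gauss_density_def c_def by (simp add: algebra_simps)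
  qed
  then have "emeasure (white_gaussian n \<sigma>) (shell n \<delta> \<sigma>) \<le> (\<integral>\<^sup>+x. ennreal c * indicator (shell n \<delta> \<sigma>) x \<partial>lebesgue_n n)"
    using assms(1) by (subst emeasure_white_gaussian)
      (auto intro!: nn_integral_mono ennreal_leI simp: indicator_def)
  also have "\<dots> = ennreal c * emeasure (lebesgue_n n) (shell n \<delta> \<sigma>)"
    by (simp add: nn_integral_cmult_indicator)
  finally have "ennreal (1 / 2) \<le> ennreal c * emeasure (lebesgue_n n) (shell n \<delta> \<sigma>)"
    using assms(2) by (rule order.trans[rotated])
  then have "ennreal (1 / c) * ennreal (1 / 2) \<le> ennreal (1 / c) * (ennreal c * emeasure (lebesgue_n n) (shell n \<delta> \<sigma>))"
    by (rule mult_left_mono) simp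
  also have "\<dots> = emeasure (lebesgue_n n) (shell n \<delta> \<sigma>)"
    unfolding mult.assoc[symmetric] using \<open>c > 0\<close> by (simp flip: ennreal_mult)
  also have "ennreal (1 / c) * ennreal (1 / 2) = ennreal (exp (n / 2 * (ln (2 * pi * \<sigma>\<^sup>2) + 1 - \<delta>)) / 2)"
  proof -
    have "c = inverse (exp (n / 2 * (ln (2 * pi * \<sigma>\<^sup>2) + 1 - \<delta>)))"
      unfolding c_def exp_minus[symmetric] by simp
    then have "1 / c = exp (n / 2 * (ln (2 * pi * \<sigma>\<^sup>2) + 1 - \<delta>))"
      by (simp only: inverse_eq_divide[symmetric] inverse_inverse_eq)
    then show ?thesis
      using \<open>c > 0\<close> by (subst ennreal_mult[symmetric]) simp_all
  qed
  finally show ?thesis .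
qed

lemma vec_ball_zero: "vec_ball n (\<lambda>_. 0) r = {x \<in> space (lebesgue_n n). vec_norm n x \<le> r}"
  by (simp add: vec_ball_def vec_dist_def vec_norm_def)

lemma ball_volume_ge:
  assumes "r > 0" "n \<ge> 1" "0 < \<delta>"
    and half: "\<forall>\<sigma>>0. ennreal (1 / 2) \<le> emeasure (white_gaussian n \<sigma>) (shell n \<delta> \<sigma>)"
  shows "exp (n / 2 * (ln (2 * pi * (r\<^sup>2 / (n * (1 + \<delta>)))) + 1 - \<delta>)) / 2 \<le> unit_ball_vol n * r ^ n"
proof -
  \<comment> \<open>This variance makes the outer radius of the shell equal to
    \<open>r\<close>.\<close>
  define \<sigma> where "\<sigma> = r / sqrt (n * (1 + \<delta>))"
  have \<sigma>: "\<sigma> > 0" "\<sigma>\<^sup>2 = r\<^sup>2 / (n * (1 + \<delta>))"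
    using assms by (auto simp: \<sigma>_def power_divide)
  have "shell n \<delta> \<sigma> \<subseteq> vec_ball n (\<lambda>_. 0) r"
    using assms by (auto simp: shell_def vec_ball_zero \<sigma>(2) intro!: power2_le_imp_le[of _ r])
  then have "emeasure (lebesgue_n n) (shell n \<delta> \<sigma>) \<le> ennreal (unit_ball_vol n * r ^ n)"
    using emeasure_mono[of "shell n \<delta> \<sigma>" "vec_ball n (\<lambda>_. 0) r" "lebesgue_n n"]
      emeasure_vec_ball[of r n "\<lambda>_. 0"] assms by simp
  with shell_volume_ge[OF \<sigma>(1)] half \<sigma>(1)
  have "ennreal (exp (n / 2 * (ln (2 * pi * \<sigma>\<^sup>2) + 1 - \<delta>)) / 2) \<le> ennreal (unit_ball_vol n * r ^ n)"
    by (meson order.trans)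
  then show ?thesis
    using assms by (subst (asm) ennreal_le_iff) (auto simp: \<sigma>(2) intro!: mult_nonneg_nonneg)
qed

text \<open>On the ball the Gaussian density is at least \<open>c\<close>, its value on the
  boundary, while the total mass is 1. Among all variances, r^2 / n gives the best bound of this
  kind.\<close>

lemma ball_volume_le:
  assumes "r > 0" "n \<ge> 1"
  shows "unit_ball_vol n * r ^ n \<le> exp (n / 2 * (ln (2 * pi * (r\<^sup>2 / n)) + 1))"
proof -
  define \<sigma> where "\<sigma> = r / sqrt n"
  have \<sigma>: "\<sigma> > 0" "\<sigma>\<^sup>2 = r\<^sup>2 / n"
    using assms by (auto simp: \<sigma>_def power_divide)
  interpret prob_space "white_gaussian n \<sigma>"
    using \<sigma>(1) by (rule prob_space_white_gaussian)
  define c where "c = exp (- (n / 2) * (ln (2 * pi * \<sigma>\<^sup>2) + 1))"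
  define B where "B = vec_ball n (\<lambda>_. 0) r"
  have [measurable]: "B \<in> sets (lebesgue_n n)" by (simp add: B_def)
  have "c \<le> gauss_density n \<sigma> x" if "x \<in> B" for x
  proof -
    have "vec_norm n x \<le> r" using that by (simp add: B_def vec_ball_zero)
    then have "(vec_norm n x)\<^sup>2 / (2 * \<sigma>\<^sup>2) \<le> r\<^sup>2 / (2 * \<sigma>\<^sup>2)"
      by (intro divide_right_mono power_mono) auto
    also have "\<dots> = n / 2" using assms by (simp add: \<sigma>(2))
    finally show ?thesis
      unfolding gauss_density_def c_def by (simp add: algebra_simps)
  qed
  then have "(\<integral>\<^sup>+x. ennreal c * indicator B x \<partial>lebesgue_n n) \<le> emeasure (white_gaussian n \<sigma>) B"
    using \<sigma>(1) by (subst emeasure_white_gaussian)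
      (auto intro!: nn_integral_mono ennreal_leI simp: indicator_def)
  also have "\<dots> \<le> ennreal 1"
    by (simp add: emeasure_eq_measure)
  also have "(\<integral>\<^sup>+x. ennreal c * indicator B x \<partial>lebesgue_n n) = ennreal c * ennreal (unit_ball_vol n * r ^ n)"
    using assms by (simp add: nn_integral_cmult_indicator B_def emeasure_vec_ball)
  finally have "c * (unit_ball_vol n * r ^ n) \<le> 1"
    by (subst (asm) ennreal_mult[symmetric]) (use assms in \<open>auto simp: c_def ennreal_le_1 intro!: mult_nonneg_nonneg\<close>)
  then show ?thesis
    by (simp add: c_def \<sigma>(2) exp_minus field_simps)
qed

text \<open>The density of variance \<open>\<sigma>\<^sup>2\<close>, bounded below by its value on
  the outer sphere, is multiplied by the volume found from variance \<open>\<tau>\<^sup>2\<close>.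
  As \<open>\<delta>\<close> tends to 0, the rate becomes (v - 1 - ln v) / 2, the relative entropy
  per coordinate of the two Gaussian laws.\<close>

lemma gaussian_shell_ge:
  assumes "\<sigma> > 0" "v > 0"
    and half: "\<forall>\<tau>>0. ennreal (1 / 2) \<le> emeasure (white_gaussian n \<tau>) (shell n \<delta> \<tau>)"
  shows "ennreal (exp (- (n / 2) * ((1 + \<delta>) * v - (1 - \<delta>) - ln v)) / 2)
    \<le> emeasure (white_gaussian n \<sigma>) (shell n \<delta> (\<sigma> * sqrt v))"
proof -
  define \<tau> where "\<tau> = \<sigma> * sqrt v"
  have \<tau>: "\<tau> > 0" "\<tau>\<^sup>2 = \<sigma>\<^sup>2 * v"
    using assms by (auto simp: \<tau>_def power_mult_distrib)
  define c where "c = exp (- (n / 2) * (ln (2 * pi * \<sigma>\<^sup>2) + (1 + \<delta>) * v))"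
  have "c \<le> gauss_density n \<sigma> x" if "x \<in> shell n \<delta> \<tau>" for x
  proof -
    have "(vec_norm n x)\<^sup>2 / (2 * \<sigma>\<^sup>2) \<le> (1 + \<delta>) * (n * \<tau>\<^sup>2) / (2 * \<sigma>\<^sup>2)"
      using that assms(1) by (intro divide_right_mono) (auto simp: shell_def)
    also have "\<dots> = n / 2 * ((1 + \<delta>) * v)"
      using assms(1) by (simp add: \<tau>(2) field_simps)
    finally show ?thesis
      unfolding gauss_density_def c_def by (simp add: algebra_simps)
  qed
  then have "(\<integral>\<^sup>+x. ennreal c * indicator (shell n \<delta> \<tau>) x \<partial>lebesgue_n n) \<le> emeasure (white_gaussian n \<sigma>) (shell n \<delta> \<tau>)"
    using assms(1) by (subst emeasure_white_gaussian)
      (auto intro!: nn_integral_mono ennreal_leI simp: indicator_def)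
  then have *: "ennreal c * emeasure (lebesgue_n n) (shell n \<delta> \<tau>) \<le> emeasure (white_gaussian n \<sigma>) (shell n \<delta> \<tau>)"
    by (simp add: nn_integral_cmult_indicator)
  have eq: "ln (2 * pi * \<tau>\<^sup>2) = ln (2 * pi * \<sigma>\<^sup>2) + ln v"
    using assms by (simp add: \<tau>(2) ln_mult)
  have "exp (- (n / 2) * ((1 + \<delta>) * v - (1 - \<delta>) - ln v)) / 2 = c * (exp (n / 2 * (ln (2 * pi * \<tau>\<^sup>2) + 1 - \<delta>)) / 2)"
    unfolding c_def eq times_divide_eq_right exp_add[symmetric] by (simp add: algebra_simps add_divide_distrib)
  then have "ennreal (exp (- (n / 2) * ((1 + \<delta>) * v - (1 - \<delta>) - ln v)) / 2)
      = ennreal c * ennreal (exp (n / 2 * (ln (2 * pi * \<tau>\<^sup>2) + 1 - \<delta>)) / 2)"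
    by (simp add: c_def flip: ennreal_mult)
  also have "\<dots> \<le> ennreal c * emeasure (lebesgue_n n) (shell n \<delta> \<tau>)"
    using half \<tau>(1) by (intro mult_left_mono shell_volume_ge) auto
  finally show ?thesis using * by (simp add: \<tau>_def)
qed

section \<open>The error exponent\<close>

text \<open>Interpolates between the trivial bound 1 and the union bound \<open>x\<close>: the
  minimum of 1 and exp t is at most exp(s t).\<close>

lemma one_minus_exp_le_powr:
  assumes "x \<le> exp (t :: real)" "0 \<le> s" "s \<le> 1"
  shows "1 - exp (- x) \<le> exp (s * t)"
proof (cases "t \<ge> 0")
  case True
  then have "1 \<le> exp (s * t)" using assms by simp
  moreover have "0 < exp (- x)" by simp
  ultimately show ?thesis by linarith
next
  case False
  then have "t \<le> s * t" using assms mult_right_mono_neg[of s 1 t] by simp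
  then have "exp t \<le> exp (s * t)" by simp
  then show ?thesis
    using exp_ge_add_one_self[of "- x"] assms(1) by linarith
qed

text \<open>Below 1 the bound by the mean count is sharp up to the factor 2.\<close>

lemma half_le_one_minus_exp:
  assumes "0 \<le> y" "y \<le> 1" "y \<le> (x :: real)"
  shows "y / 2 \<le> 1 - exp (- x)"
proof -
  have "y / 2 \<le> y / (1 + y)"
    using assms by (intro divide_left_mono) auto
  also have "\<dots> = 1 - 1 / (1 + y)"
    using assms by (simp add: field_simps)
  also have "\<dots> \<le> 1 - exp (- y)"
    using exp_ge_add_one_self[of y] assms by (simp add: exp_minus field_simps)
  also have "\<dots> \<le> 1 - exp (- x)"
    using assms by simp
  finally show ?thesis .
qed

text \<open>\<open>\<Lambda>\<close> is written so that multiplying it by the volume bound leaves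
  exp((n / 2) (ln w - a)). The tangent to ln at \<open>1 + s\<close> then makes the exponent linear
  in the squared norm, with slope governed by \<open>u\<close> and constant term
  \<open>c\<close>.\<close>

lemma average_error_le:
  fixes n :: nat
  assumes n: "n \<ge> 1" and \<sigma>: "\<sigma> > 0" and s: "0 < s" "s \<le> 1"
    and \<Lambda>: "\<Lambda> = exp (- (n / 2) * (ln (2 * pi * \<sigma>\<^sup>2) + 1 + a))"
  shows "(\<integral>\<^sup>+d. ennreal (1 - exp (- (\<Lambda> * (unit_ball_vol n * vec_norm n d ^ n)))) \<partial>white_gaussian n \<sigma>)
    \<le> ennreal (exp (- (n / 2) * (s * a + s - (1 + s) * ln (1 + s))))"
proof -
  define c where "c = s * (n / 2) * (ln (1 + s) - a - 1)"
  define u where "u = s / (1 + s)"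
  have u: "u < 1" using s by (simp add: u_def)
  have pointwise: "1 - exp (- (\<Lambda> * (unit_ball_vol n * vec_norm n d ^ n)))
    \<le> exp c * exp (u * (vec_norm n d)\<^sup>2 / (2 * \<sigma>\<^sup>2))" for d
  \<comment> \<open>At norm 0 the logarithm of \<open>w\<close> would be meaningless, but the
    conditional error is 0.\<close>
  proof (cases "vec_norm n d = 0")
    case True
    then show ?thesis using n by (simp add: power_0_left)
  next
    case False
    then have r: "vec_norm n d > 0"
      using vec_norm_nonneg[of n d] by linarith
    define w where "w = (vec_norm n d)\<^sup>2 / (n * \<sigma>\<^sup>2)"
    have w: "w > 0" using r n \<sigma> by (simp add: w_def)
    have "2 * pi * ((vec_norm n d)\<^sup>2 / n) = (2 * pi * \<sigma>\<^sup>2) * w"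
      using \<sigma> by (simp add: w_def)
    then have ln_eq: "ln (2 * pi * ((vec_norm n d)\<^sup>2 / n)) = ln (2 * pi * \<sigma>\<^sup>2) + ln w"
      using w \<sigma> by (simp add: ln_mult)
    have "\<Lambda> * (unit_ball_vol n * vec_norm n d ^ n) \<le> \<Lambda> * exp (n / 2 * (ln (2 * pi * ((vec_norm n d)\<^sup>2 / n)) + 1))"
      using ball_volume_le[OF r n] by (intro mult_left_mono) (auto simp: \<Lambda>)
    also have "\<dots> = exp (n / 2 * (ln w - a))"
      unfolding ln_eq \<Lambda> exp_add[symmetric] by (simp add: algebra_simps)
    finally have "1 - exp (- (\<Lambda> * (unit_ball_vol n * vec_norm n d ^ n))) \<le> exp (s * (n / 2 * (ln w - a)))"
      using s by (intro one_minus_exp_le_powr) auto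
    also have "\<dots> \<le> exp (s * (n / 2 * (ln (1 + s) + w / (1 + s) - 1 - a)))"
    proof -
      have "ln (w / (1 + s)) \<le> w / (1 + s) - 1"
        using w s by (intro ln_le_minus_one) auto
      then have "ln w \<le> ln (1 + s) + w / (1 + s) - 1"
        using w s by (simp add: ln_div)
      then show ?thesis
        using s by (auto intro!: mult_left_mono)
    qed
    also have "s * (n / 2 * (ln (1 + s) + w / (1 + s) - 1 - a)) = c + u * (n * w / 2)"
      using s by (simp add: c_def u_def field_simps)
    also have "n * w / 2 = (vec_norm n d)\<^sup>2 / (2 * \<sigma>\<^sup>2)"
      using n by (simp add: w_def)
    finally show ?thesis
      by (simp add: exp_add)
  qed
  have "(\<integral>\<^sup>+d. ennreal (1 - exp (- (\<Lambda> * (unit_ball_vol n * vec_norm n d ^ n)))) \<partial>white_gaussian n \<sigma>)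
    \<le> (\<integral>\<^sup>+d. ennreal (exp c) * ennreal (exp (u * (vec_norm n d)\<^sup>2 / (2 * \<sigma>\<^sup>2))) \<partial>white_gaussian n \<sigma>)"
    by (intro nn_integral_mono, subst ennreal_mult[symmetric]) (auto intro!: ennreal_leI pointwise)
  also have "\<dots> = ennreal (exp c) * (\<integral>\<^sup>+d. ennreal (exp (u * (vec_norm n d)\<^sup>2 / (2 * \<sigma>\<^sup>2))) \<partial>white_gaussian n \<sigma>)"
    by (intro nn_integral_cmult) measurable
  also have "\<dots> = ennreal (exp (c - (n / 2) * ln (1 - u)))"
    unfolding gaussian_exp_moment[OF \<sigma> u] by (simp flip: ennreal_mult exp_add)
  also have "ln (1 - u) = - ln (1 + s)"
    using s by (simp add: u_def ln_inverse[symmetric] field_simps)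
  also have "c - (n / 2) * - ln (1 + s) = - (n / 2) * (s * a + s - (1 + s) * ln (1 + s))"
    by (simp add: c_def algebra_simps diff_divide_distrib add_divide_distrib)
  finally show ?thesis .
qed

text \<open>The factor 1/8 collects three halves: from the volume of the ball, from
  \<open>half_le_one_minus_exp\<close>, and from the mass of the shell. The terms in
  \<open>\<delta>\<close> are the cost of a shell of positive width.\<close>

lemma average_error_ge:
  fixes n :: nat
  assumes n: "n \<ge> 1" and \<sigma>: "\<sigma> > 0" and v: "0 < v" "ln v \<le> a" and \<delta>: "0 < \<delta>" "\<delta> < 1"
    and \<Lambda>: "\<Lambda> = exp (- (n / 2) * (ln (2 * pi * \<sigma>\<^sup>2) + 1 + a))"
    and half: "\<forall>\<tau>>0. ennreal (1 / 2) \<le> emeasure (white_gaussian n \<tau>) (shell n \<delta> \<tau>)"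
  shows "ennreal (exp (- (n / 2) * (v - 1 - 2 * ln v + a + (v * \<delta> + 2 * \<delta> + ln (1 + \<delta>) - ln (1 - \<delta>)))) / 8)
    \<le> (\<integral>\<^sup>+d. ennreal (1 - exp (- (\<Lambda> * (unit_ball_vol n * vec_norm n d ^ n)))) \<partial>white_gaussian n \<sigma>)"
proof -
  define S where "S = shell n \<delta> (\<sigma> * sqrt v)"
  define c where "c = a - ln v + ln (1 + \<delta>) - ln (1 - \<delta>) + \<delta>"
  \<comment> \<open>Bounds \<open>\<Lambda>\<close> times the volume of the error ball from below on
    the shell. The assumption \<open>ln v \<le> a\<close> gives \<open>c \<ge> 0\<close>, hence
    \<open>y \<le> 1\<close>.\<close>
  define y where "y = exp (- (n / 2) * c) / 2"
  have [measurable]: "S \<in> sets (lebesgue_n n)" by (simp add: S_def)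
  have "0 \<le> ln (1 + \<delta>)" "ln (1 - \<delta>) \<le> 0"
    using \<delta> by (auto simp: ln_le_zero_iff)
  then have "c \<ge> 0"
    unfolding c_def using v \<delta> by linarith
  then have y: "0 \<le> y" "y \<le> 1"
    using order.trans[of "exp (- (n / 2) * c)" 1 2] by (auto simp: y_def)
  have pointwise: "y / 2 \<le> 1 - exp (- (\<Lambda> * (unit_ball_vol n * vec_norm n d ^ n)))" if "d \<in> S" for d
  proof -
    have le: "(1 - \<delta>) * (n * (\<sigma>\<^sup>2 * v)) \<le> (vec_norm n d)\<^sup>2"
      using that v by (auto simp: S_def shell_def power_mult_distrib)
    moreover have pos: "0 < (1 - \<delta>) * (n * (\<sigma>\<^sup>2 * v))"
      using v \<delta> \<sigma> n by simp
    ultimately have "(vec_norm n d)\<^sup>2 > 0" by linarith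
    then have r: "vec_norm n d > 0"
      by (metis less_eq_real_def vec_norm_nonneg power_zero_numeral less_irrefl)
    have "(2 * pi * \<sigma>\<^sup>2) * v * (1 - \<delta>) / (1 + \<delta>) = 2 * pi * (((1 - \<delta>) * (n * (\<sigma>\<^sup>2 * v))) / (n * (1 + \<delta>)))"
      using n by simp
    also have "\<dots> \<le> 2 * pi * ((vec_norm n d)\<^sup>2 / (n * (1 + \<delta>)))"
      using le \<delta> by (intro mult_left_mono divide_right_mono) auto
    finally have "ln ((2 * pi * \<sigma>\<^sup>2) * v * (1 - \<delta>) / (1 + \<delta>)) \<le> ln (2 * pi * ((vec_norm n d)\<^sup>2 / (n * (1 + \<delta>))))"
      using v \<delta> \<sigma> by (intro ln_mono) auto
    moreover have "ln ((2 * pi * \<sigma>\<^sup>2) * v * (1 - \<delta>) / (1 + \<delta>)) = ln (2 * pi * \<sigma>\<^sup>2) + ln v + ln (1 - \<delta>) - ln (1 + \<delta>)"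
    proof -
      show ?thesis using v \<delta> \<sigma> by (simp add: ln_div ln_mult)
    qed
    ultimately have "n / 2 * (ln (2 * pi * \<sigma>\<^sup>2) + ln v + ln (1 - \<delta>) - ln (1 + \<delta>) + 1 - \<delta>)
        \<le> n / 2 * (ln (2 * pi * ((vec_norm n d)\<^sup>2 / (n * (1 + \<delta>)))) + 1 - \<delta>)"
      by (intro mult_left_mono) auto
    then have "exp (n / 2 * (ln (2 * pi * \<sigma>\<^sup>2) + ln v + ln (1 - \<delta>) - ln (1 + \<delta>) + 1 - \<delta>)) / 2
        \<le> exp (n / 2 * (ln (2 * pi * ((vec_norm n d)\<^sup>2 / (n * (1 + \<delta>)))) + 1 - \<delta>)) / 2"
      by (intro divide_right_mono) auto
    also have "\<dots> \<le> unit_ball_vol n * vec_norm n d ^ n"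
      using r n \<delta>(1) half by (rule ball_volume_ge)
    finally have "\<Lambda> * (exp (n / 2 * (ln (2 * pi * \<sigma>\<^sup>2) + ln v + ln (1 - \<delta>) - ln (1 + \<delta>) + 1 - \<delta>)) / 2)
        \<le> \<Lambda> * (unit_ball_vol n * vec_norm n d ^ n)"
      by (intro mult_left_mono) (auto simp: \<Lambda>)
    moreover have "\<Lambda> * (exp (n / 2 * (ln (2 * pi * \<sigma>\<^sup>2) + ln v + ln (1 - \<delta>) - ln (1 + \<delta>) + 1 - \<delta>)) / 2) = y"
      unfolding \<Lambda> y_def c_def times_divide_eq_right exp_add[symmetric]
      by (simp add: algebra_simps add_divide_distrib diff_divide_distrib)
    ultimately show ?thesis
      using y by (intro half_le_one_minus_exp) auto
  qed
  have "ennreal (exp (- (n / 2) * (v - 1 - 2 * ln v + a + (v * \<delta> + 2 * \<delta> + ln (1 + \<delta>) - ln (1 - \<delta>)))) / 8)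
      = ennreal (y / 2) * ennreal (exp (- (n / 2) * ((1 + \<delta>) * v - (1 - \<delta>) - ln v)) / 2)"
  proof -
    have "exp (- (n / 2) * c) * exp (- (n / 2) * ((1 + \<delta>) * v - (1 - \<delta>) - ln v))
        = exp (- (n / 2) * (v - 1 - 2 * ln v + a + (v * \<delta> + 2 * \<delta> + ln (1 + \<delta>) - ln (1 - \<delta>))))"
      unfolding c_def exp_add[symmetric] distrib_left[symmetric] by (simp add: algebra_simps)
    then show ?thesis
      by (subst ennreal_mult[symmetric]) (simp_all add: y_def)
  qed
  also have "\<dots> \<le> ennreal (y / 2) * emeasure (white_gaussian n \<sigma>) S"
    unfolding S_def using \<sigma> v(1) half by (intro mult_left_mono gaussian_shell_ge) auto
  also have "\<dots> = (\<integral>\<^sup>+d. ennreal (y / 2) * indicator S d \<partial>white_gaussian n \<sigma>)"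
    by (simp add: nn_integral_cmult_indicator sets_white_gaussian)
  also have "\<dots> \<le> (\<integral>\<^sup>+d. ennreal (1 - exp (- (\<Lambda> * (unit_ball_vol n * vec_norm n d ^ n)))) \<partial>white_gaussian n \<sigma>)"
    by (intro nn_integral_mono) (auto simp: indicator_def intro!: ennreal_leI pointwise)
  finally show ?thesis .
qed

text \<open>The two bounds give a genuine limit, with which the lower limit coincides; the constant
  8 disappears after division by \<open>n\<close>.\<close>

lemma lower_error_exponent_eqI:
  assumes le: "\<And>n. n \<ge> 1 \<Longrightarrow> p n \<le> exp (- real n * E)"
    and ge: "\<And>\<epsilon>. \<epsilon> > 0 \<Longrightarrow> \<forall>\<^sub>F n in sequentially. exp (- real n * (E + \<epsilon>)) / 8 \<le> p n"
  shows "lower_error_exponent p = ereal E"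
proof -
  have pos: "\<forall>\<^sub>F n in sequentially. 0 < p n"
    using ge[OF zero_less_one] by eventually_elim (erule less_le_trans[rotated], simp)
  have "(\<lambda>n. - (1 / real n) * ln (p n)) \<longlonglongrightarrow> E"
  proof (rule order_tendstoI)
    fix x assume "x < E"
    show "\<forall>\<^sub>F n in sequentially. x < - (1 / real n) * ln (p n)"
      using pos eventually_ge_at_top[of 1]
    proof eventually_elim
      case (elim n)
      then have "ln (p n) \<le> - real n * E"
        using le[of n] ln_mono[of "p n" "exp (- real n * E)"] by simp
      then have "real n * E \<le> - ln (p n)" by simp
      then have "E \<le> - (1 / real n) * ln (p n)"
        using elim by (simp add: field_simps)
      with \<open>x < E\<close> show ?case by linarith
    qed
  next
    fix x assume x: "E < x"
    define \<epsilon> where "\<epsilon> = (x - E) / 2"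
    have \<epsilon>: "\<epsilon> > 0" using x by (simp add: \<epsilon>_def)
    have "(\<lambda>n. ln 8 / real n) \<longlonglongrightarrow> 0"
      by (rule lim_const_over_n)
    then have small: "\<forall>\<^sub>F n in sequentially. ln 8 / real n < \<epsilon>"
      using \<epsilon> by (rule order_tendstoD)
    show "\<forall>\<^sub>F n in sequentially. - (1 / real n) * ln (p n) < x"
      using pos ge[OF \<epsilon>] small eventually_ge_at_top[of 1]
    proof eventually_elim
      case (elim n)
      have "ln (exp (- real n * (E + \<epsilon>)) / 8) \<le> ln (p n)"
        using elim by (intro ln_mono) auto
      then have "- real n * (E + \<epsilon>) - ln 8 \<le> ln (p n)"
        by (simp add: ln_div)
      then have "- ln (p n) / real n \<le> (real n * (E + \<epsilon>) + ln 8) / real n"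
        by (intro divide_right_mono) auto
      also have "\<dots> = E + \<epsilon> + ln 8 / real n"
        using elim by (simp add: field_simps)
      also have "\<dots> < x"
        using elim(3) by (simp add: \<epsilon>_def field_simps)
      finally show ?case by simp
    qed
  qed
  then have "(\<lambda>n. ereal (- (1 / real n) * ln (p n))) \<longlonglongrightarrow> ereal E"
    by simp
  \<comment> \<open>Eventually \<open>p n\<close> is positive, so the infinite branch is irrelevant
    to the limit.\<close>
  then have "(\<lambda>n. if p n = 0 then \<infinity> else ereal (- (1 / real n) * ln (p n))) \<longlonglongrightarrow> ereal E"
    by (rule Lim_transform_eventually) (use pos in \<open>auto elim!: eventually_mono\<close>)
  then show ?thesis
    unfolding lower_error_exponent_def by (intro lim_imp_Liminf) auto
qed

theorem mainTheorem5:
  fixes \<sigma> \<alpha> R :: real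
    and M :: "nat \<Rightarrow> 'a measure"
    and T D :: "nat \<Rightarrow> nat \<Rightarrow> 'a \<Rightarrow> vec"
  assumes "\<sigma> > 0" and "\<alpha> > 1"
    and "R = 1 / 2 * ln (1 / (2 * pi * exp 1 * \<alpha>\<^sup>2 * \<sigma>\<^sup>2))"
    and "\<And>n. n \<ge> 1 \<Longrightarrow> prob_space (M n)"
    and "\<And>n k. n \<ge> 1 \<Longrightarrow> T n k \<in> measurable (M n) (lebesgue_n n)"
    and "\<And>n k. n \<ge> 1 \<Longrightarrow> D n k \<in> measurable (M n) (lebesgue_n n)"
    and "\<And>n. n \<ge> 1 \<Longrightarrow> homogeneous_poisson (M n) n (exp (real n * R)) (point_process n (T n))"
    and "\<And>n. n \<ge> 1 \<Longrightarrow> iid_displacements (M n) n (T n) (D n) (white_gaussian n \<sigma>)"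
  shows "lower_error_exponent (\<lambda>n. error_probability (M n) n (T n) (D n)) =
    ereal (if \<alpha> < sqrt 2 then \<alpha>\<^sup>2 / 2 - 1 / 2 - ln \<alpha> else 1 / 2 - ln 2 + ln \<alpha>)"
proof -
  \<comment> \<open>\<open>a / 2\<close> is the distance by which the rate \<open>R\<close> lies
    below the threshold (1/2) ln(1 / (2 pi e sigma^2)).\<close>
  define a where "a = ln (\<alpha>\<^sup>2)"
  \<comment> \<open>\<open>average_error_le\<close> with s = v - 1 requires v <= 2, and
    \<open>average_error_ge\<close> requires ln v <= a. Since v - 1 - 2 ln v decreases up to 2, the
    largest such v is best.\<close>
  define v where "v = (if \<alpha> < sqrt 2 then \<alpha>\<^sup>2 else 2)"
  define E where "E = (v - 1 - 2 * ln v + a) / 2"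
  define \<Lambda> where "\<Lambda> n = exp (real n * R)" for n
  let ?p = "\<lambda>n. error_probability (M n) n (T n) (D n)"
  have sq: "1 < \<alpha>\<^sup>2" and lt: "\<alpha> < sqrt 2 \<longleftrightarrow> \<alpha>\<^sup>2 < 2"
    using \<open>\<alpha> > 1\<close> real_less_rsqrt[of \<alpha> 2] real_sqrt_less_iff[of "\<alpha>\<^sup>2" 2] by (auto simp: one_less_power)
  have v: "1 < v" "v \<le> 2" "v \<le> \<alpha>\<^sup>2"
    using sq lt by (auto simp: v_def)
  have E: "E = (if \<alpha> < sqrt 2 then \<alpha>\<^sup>2 / 2 - 1 / 2 - ln \<alpha> else 1 / 2 - ln 2 + ln \<alpha>)"
    using \<open>\<alpha> > 1\<close> by (simp add: E_def v_def a_def ln_realpow field_simps)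
  \<comment> \<open>The exponents of the upper and the lower bound differ by (v - 2) (a - ln v),
    which vanishes in both cases.\<close>
  have E': "(v - 1) * a + (v - 1) - v * ln v = 2 * E"
  proof (cases "\<alpha> < sqrt 2")
    case True
    then have "a = ln v" by (simp add: v_def a_def)
    then show ?thesis by (simp add: E_def algebra_simps)
  qed (simp add: E_def v_def)
  have R: "R = - (1 / 2) * (ln (2 * pi * \<sigma>\<^sup>2) + 1 + a)"
  proof -
    have eq: "2 * pi * exp 1 * \<alpha>\<^sup>2 * \<sigma>\<^sup>2 = (2 * pi * \<sigma>\<^sup>2) * exp 1 * \<alpha>\<^sup>2" by simp
    have "2 * pi * \<sigma>\<^sup>2 > 0" "\<alpha>\<^sup>2 > 0" using \<open>\<sigma> > 0\<close> \<open>\<alpha> > 1\<close> by auto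
    moreover have "ln (x * exp 1 * y) = ln x + 1 + ln y" if "x > 0" "y > 0" for x y :: real
      using that by (simp add: ln_mult)
    ultimately have "ln ((2 * pi * \<sigma>\<^sup>2) * exp 1 * \<alpha>\<^sup>2) = ln (2 * pi * \<sigma>\<^sup>2) + 1 + a"
      unfolding a_def by blast
    then have "ln (1 / (2 * pi * exp 1 * \<alpha>\<^sup>2 * \<sigma>\<^sup>2)) = - (ln (2 * pi * \<sigma>\<^sup>2) + 1 + a)"
      unfolding eq inverse_eq_divide[symmetric] using \<open>\<sigma> > 0\<close> \<open>\<alpha> > 1\<close> by (subst ln_inverse) auto
    then show ?thesis unfolding assms(3) by algebra
  qed
  have \<Lambda>: "\<Lambda> n = exp (- (n / 2) * (ln (2 * pi * \<sigma>\<^sup>2) + 1 + a))" for n :: nat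
    by (simp add: \<Lambda>_def R)
  have formula: "ennreal (?p n) = (\<integral>\<^sup>+d. ennreal (1 - exp (- (\<Lambda> n * (unit_ball_vol n * vec_norm n d ^ n)))) \<partial>white_gaussian n \<sigma>)"
    if n: "n \<ge> 1" for n
  proof -
    interpret prob_space "M n" using n by (rule assms(4))
    interpret poisson_points "M n" n "\<Lambda> n" "T n"
      using assms(5,7) n by unfold_locales (auto simp: \<Lambda>_def)
    show ?thesis
      using assms(6,8) n by (intro error_probability_eq) auto
  qed
  have nonneg: "0 \<le> ?p n" for n
    by (simp add: error_probability_def)
  have "lower_error_exponent ?p = ereal E"
  proof (rule lower_error_exponent_eqI)
    fix n :: nat assume n: "n \<ge> 1"
    have "ennreal (?p n) \<le> ennreal (exp (- (n / 2) * ((v - 1) * a + (v - 1) - (1 + (v - 1)) * ln (1 + (v - 1)))))"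
      unfolding formula[OF n] using n \<open>\<sigma> > 0\<close> v by (intro average_error_le \<Lambda>) auto
    also have "(v - 1) * a + (v - 1) - (1 + (v - 1)) * ln (1 + (v - 1)) = 2 * E"
      using E' by simp
    finally show "?p n \<le> exp (- real n * E)"
      by (subst (asm) ennreal_le_iff) simp_all
  next
    fix \<epsilon> :: real assume "\<epsilon> > 0"
    \<comment> \<open>The cost of the shell's width tends to 0 with \<open>\<delta>\<close>. It may
      reach 2 epsilon, since it is multiplied by \<open>n / 2\<close>.\<close>
    have "((\<lambda>\<delta>. v * \<delta> + 2 * \<delta> + ln (1 + \<delta>) - ln (1 - \<delta>)) \<longlongrightarrow> v * 0 + 2 * 0 + ln (1 + 0) - ln (1 - 0)) (at_right 0)"
      by (intro tendsto_intros) auto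
    then have "\<forall>\<^sub>F \<delta> in at_right 0. v * \<delta> + 2 * \<delta> + ln (1 + \<delta>) - ln (1 - \<delta>) < 2 * \<epsilon>"
      using \<open>\<epsilon> > 0\<close> by (intro order_tendstoD) auto
    moreover have "\<forall>\<^sub>F \<delta> in at_right (0 :: real). \<delta> \<in> {0<..<1}"
      by (rule eventually_at_right_real) simp
    ultimately have "\<forall>\<^sub>F \<delta> in at_right 0. v * \<delta> + 2 * \<delta> + ln (1 + \<delta>) - ln (1 - \<delta>) < 2 * \<epsilon> \<and> \<delta> \<in> {0<..<1}"
      by (rule eventually_conj)
    then obtain \<delta> where \<delta>: "v * \<delta> + 2 * \<delta> + ln (1 + \<delta>) - ln (1 - \<delta>) < 2 * \<epsilon>" "0 < \<delta>" "\<delta> < 1"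
      by (auto dest!: eventually_happens)
    show "\<forall>\<^sub>F n in sequentially. exp (- real n * (E + \<epsilon>)) / 8 \<le> ?p n"
      using eventually_shell_half[OF \<delta>(2,3)] eventually_ge_at_top[of 1]
    proof eventually_elim
      case (elim n)
      have "real n / 2 * (v - 1 - 2 * ln v + a + (v * \<delta> + 2 * \<delta> + ln (1 + \<delta>) - ln (1 - \<delta>)))
          \<le> real n / 2 * (2 * E + 2 * \<epsilon>)"
        using \<delta>(1) by (intro mult_left_mono) (auto simp: E_def field_simps)
      then have "exp (- real n * (E + \<epsilon>)) / 8
          \<le> exp (- (n / 2) * (v - 1 - 2 * ln v + a + (v * \<delta> + 2 * \<delta> + ln (1 + \<delta>) - ln (1 - \<delta>)))) / 8"
        by (intro divide_right_mono) (auto simp: algebra_simps)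
      also have "\<dots> \<le> ?p n"
      proof -
        have "ln v \<le> a"
          using v by (auto simp: a_def intro!: ln_mono)
        then have "ennreal (exp (- (n / 2) * (v - 1 - 2 * ln v + a + (v * \<delta> + 2 * \<delta> + ln (1 + \<delta>) - ln (1 - \<delta>)))) / 8)
            \<le> ennreal (?p n)"
          unfolding formula[OF elim(2)] using elim \<open>\<sigma> > 0\<close> v \<delta>
          by (intro average_error_ge \<Lambda>) auto
        then show ?thesis
          using nonneg by (subst (asm) ennreal_le_iff) auto
      qed
      finally show ?case .
    qed
  qed
  then show ?thesis by (simp add: E)
qed

end
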